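(* For every positive integer $k$, the operator $T^k-T_\perp^k$ is trace class and $$\tau_k:=\operatorname{Tr}(T^k-T_\perp^k)=\sum_{n=1}^{\infty}\left(\frac1{n^k}-\frac1{\rho_n^k}\right).$$ Moreover, we have $$\log\mathcal{H}(z)=\sum_{k=1}^{\infty}\frac{\tau_k}{k}z^k\quad\text{for}\quad|z|<1.$$ In particular, we have $$\gamma=\operatorname{Tr}(T-T_\perp)=\sum_{n=1}^{\infty}\left(\frac1n-\frac1{\rho_n}\right).$$
   Context: $\mathbb{N}=\{1,2,\ldots\}$; $\gamma$ is Euler's constant. The Gregory coefficients $(G_n)_{n\ge0}$ are defined by $\frac{z}{\log(1+z)}=\sum_{n=0}^{\infty}G_nz^n$ for $|z|<1$; they satisfy $\sum_{n\ge1}|G_n|=1$. The Gregory function is the entire function $\mathcal{G}(z)=\frac{1}{\Gamma(z+1)}\int_0^1\frac{\Gamma(x+1)}{\Gamma(x-z+1)}\,dx$ (with $1/\Gamma$ entire), and the completed Gregory transform is $\mathcal{H}(z)=\frac{\pi z}{\sin\pi z}\mathcal{G}(z)$, regarded as a holomorphic function on $\mathbb{C}\setminus\mathbb{N}$ (the singularities at nonpositive integers are removable); $\mathcal{H}(0)=1$, and $\log\mathcal{H}$ on $|z|<1$ is the holomorphic branch vanishing at $z=0$. For each $n\ge1$, $\rho_n$ denotes the unique zero of $\mathcal{H}$ (equivalently of $\mathcal{G}$) in the interval $(n,n+1)$. On the Hilbert space $\ell^2(\mathbb{N})$ with standard orthonormal basis $(e_n)_{n\ge1}$, let $T$ be the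 bounded diagonal operator $Te_n=\frac1n e_n$, and let $u=\sum_{n=1}^{\infty}\sqrt{|G_n|}\,e_n$, a unit vector. Let $Q$ be the orthogonal projection onto $\mathbb{C}u$, $P=I-Q$, and $T_\perp=PTP$. *)

theory Defs
  imports "HOL-Complex_Analysis.Complex_Analysis"
begin

section \<open>The Gregory coefficients, the Gregory function and its completed transform\<close>

text \<open>The value 1 at \<open>z = 0\<close> is the removable singularity of \<open>z / log (1 + z)\<close>.\<close>

definition gregory_coeff :: "nat \<Rightarrow> real" where
  "gregory_coeff = (THE G. \<forall>z::complex. norm z < 1 \<longrightarrow>
     (\<lambda>n. complex_of_real (G n) * z ^ n) sums (if z = 0 then 1 else z / Ln (1 + z)))"

definition gregory_fun :: "complex \<Rightarrow> complex" where
  "gregory_fun z =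
     rGamma (z + 1) * integral {0..1} (\<lambda>x::real. Gamma (of_real x + 1) * rGamma (of_real x - z + 1))"

text \<open>
  Here \<open>remove_sings\<close> fills in the limits at the nonpositive integers. The positive integers lie
  outside the domain of the transform; at a pole the value is the dummy 0.
\<close>

definition gregory_H :: "complex \<Rightarrow> complex" where
  "gregory_H = remove_sings (\<lambda>z. of_real pi * z / sin (of_real pi * z) * gregory_fun z)"

definition is_log_H :: "(complex \<Rightarrow> complex) \<Rightarrow> bool" where
  "is_log_H L \<longleftrightarrow> L holomorphic_on ball 0 1 \<and> L 0 = 0 \<and> (\<forall>z\<in>ball 0 1. exp (L z) = gregory_H z)"

definition gregory_rho :: "nat \<Rightarrow> real" where
  "gregory_rho n = (THE x. real n < x \<and> x < real n + 1 \<and> gregory_H (of_real x) = 0)"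


section \<open>The complex Hilbert space of square-summable sequences indexed by 1, 2, ...\<close>

text \<open>
  Index 0 is a dummy whose coordinate is always 0, so that the coordinates are those indexed by
  the positive integers.
\<close>

typedef ell2 = "{x :: nat \<Rightarrow> complex. x 0 = 0 \<and> summable (\<lambda>n. (cmod (x n))\<^sup>2)}"
  morphisms coord Abs_ell2
  by (rule exI[of _ "\<lambda>_. 0"]) simp

setup_lifting type_definition_ell2

lemma ell2_eqI: "(\<And>n. coord x n = coord y n) \<Longrightarrow> x = y"
  by (metis coord_inject ext)

lemma summable_norm_coord: "summable (\<lambda>n. (cmod (coord x n))\<^sup>2)"
  using coord[of x] by simp

lemma summable_cmod_mult_coord: "summable (\<lambda>n. cmod (coord x n) * cmod (coord y n))"
proof (rule summable_comparison_test')
  show "summable (\<lambda>n. (cmod (coord x n))\<^sup>2 + (cmod (coord y n))\<^sup>2)"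
    by (intro summable_add summable_norm_coord)
  show "norm (cmod (coord x n) * cmod (coord y n)) \<le> (cmod (coord x n))\<^sup>2 + (cmod (coord y n))\<^sup>2"
    for n
  proof -
    have "2 * cmod (coord x n) * cmod (coord y n) \<le> (cmod (coord x n))\<^sup>2 + (cmod (coord y n))\<^sup>2"
      by (rule sum_squares_bound)
    moreover have "0 \<le> cmod (coord x n) * cmod (coord y n)"
      by simp
    ultimately have "cmod (coord x n) * cmod (coord y n) \<le> (cmod (coord x n))\<^sup>2 + (cmod (coord y n))\<^sup>2"
      by linarith
    then show ?thesis
      by simp
  qed
qed

lemma summable_cnj_mult_coord: "summable (\<lambda>n. cnj (coord x n) * coord y n)"
  by (rule summable_norm_cancel) (simp add: norm_mult summable_cmod_mult_coord)

lemma summable_square_add: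
  fixes x y :: "nat \<Rightarrow> complex"
  assumes "summable (\<lambda>n. (cmod (x n))\<^sup>2)" "summable (\<lambda>n. (cmod (y n))\<^sup>2)"
  shows "summable (\<lambda>n. (cmod (x n + y n))\<^sup>2)"
proof (rule summable_comparison_test')
  show "summable (\<lambda>n. 2 * ((cmod (x n))\<^sup>2 + (cmod (y n))\<^sup>2))"
    using assms by (intro summable_mult summable_add)
  show "norm ((cmod (x n + y n))\<^sup>2) \<le> 2 * ((cmod (x n))\<^sup>2 + (cmod (y n))\<^sup>2)" for n
  proof -
    have "(cmod (x n + y n))\<^sup>2 \<le> (cmod (x n) + cmod (y n))\<^sup>2"
      by (intro power_mono norm_triangle_ineq) simp
    also have "\<dots> \<le> 2 * ((cmod (x n))\<^sup>2 + (cmod (y n))\<^sup>2)"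
      using sum_squares_bound[of "cmod (x n)" "cmod (y n)"] by (simp add: power2_sum)
    finally show ?thesis
      by simp
  qed
qed

lemma summable_square_divide_nat:
  fixes x :: "nat \<Rightarrow> complex"
  assumes "summable (\<lambda>n. (cmod (x n))\<^sup>2)"
  shows "summable (\<lambda>n. (cmod (x n / of_nat n))\<^sup>2)"
proof (rule summable_comparison_test'[OF assms])
  show "norm ((cmod (x n / of_nat n))\<^sup>2) \<le> (cmod (x n))\<^sup>2" for n
    by (cases "n = 0") (auto simp: norm_divide divide_le_eq mult_le_cancel_left1 intro!: power_mono)
qed

text \<open>The inner product is conjugate-linear in the first argument.\<close>

definition cinner :: "ell2 \<Rightarrow> ell2 \<Rightarrow> complex" where
  "cinner x y = (\<Sum>n. cnj (coord x n) * coord y n)"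

lift_definition cscale :: "complex \<Rightarrow> ell2 \<Rightarrow> ell2" is "\<lambda>c x n. c * x n"
  by (auto simp: norm_mult power_mult_distrib intro!: summable_mult)

instantiation ell2 :: real_inner
begin

lift_definition zero_ell2 :: ell2 is "\<lambda>_. 0"
  by simp

lift_definition plus_ell2 :: "ell2 \<Rightarrow> ell2 \<Rightarrow> ell2" is "\<lambda>x y n. x n + y n"
  by (auto intro: summable_square_add)

lift_definition uminus_ell2 :: "ell2 \<Rightarrow> ell2" is "\<lambda>x n. - x n"
  by simp

definition minus_ell2 :: "ell2 \<Rightarrow> ell2 \<Rightarrow> ell2" where
  "minus_ell2 x y = x + - y"

definition scaleR_ell2 :: "real \<Rightarrow> ell2 \<Rightarrow> ell2" where
  "scaleR_ell2 r x = cscale (of_real r) x"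

definition inner_ell2 :: "ell2 \<Rightarrow> ell2 \<Rightarrow> real" where
  "inner_ell2 x y = Re (cinner x y)"

definition norm_ell2 :: "ell2 \<Rightarrow> real" where
  "norm_ell2 x = sqrt (inner x x)"

definition dist_ell2 :: "ell2 \<Rightarrow> ell2 \<Rightarrow> real" where
  "dist_ell2 x y = norm (x - y)"

definition sgn_ell2 :: "ell2 \<Rightarrow> ell2" where
  "sgn_ell2 x = scaleR (inverse (norm x)) x"

definition uniformity_ell2 :: "(ell2 \<times> ell2) filter" where
  "uniformity_ell2 = (INF e\<in>{0<..}. principal {(x, y). dist x y < e})"

definition open_ell2 :: "ell2 set \<Rightarrow> bool" where
  "open_ell2 U \<longleftrightarrow> (\<forall>x\<in>U. \<forall>\<^sub>F (x', y) in uniformity. x' = x \<longrightarrow> y \<in> U)"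

instance
proof
  fix x y z :: ell2 and r s :: real
  note coords = plus_ell2.rep_eq zero_ell2.rep_eq uminus_ell2.rep_eq cscale.rep_eq
    minus_ell2_def scaleR_ell2_def
  show "x + y + z = x + (y + z)" "x + y = y + x" "0 + x = x" "- x + x = 0" "x - y = x + - y"
    "r *\<^sub>R (x + y) = r *\<^sub>R x + r *\<^sub>R y" "(r + s) *\<^sub>R x = r *\<^sub>R x + s *\<^sub>R x"
    "r *\<^sub>R s *\<^sub>R x = (r * s) *\<^sub>R x" "1 *\<^sub>R x = x"
    by (auto intro!: ell2_eqI simp: coords algebra_simps)
  show "dist x y = norm (x - y)" "sgn x = scaleR (inverse (norm x)) x" "norm x = sqrt (inner x x)"
    by (simp_all add: dist_ell2_def sgn_ell2_def norm_ell2_def)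
  show "uniformity = (INF e\<in>{0<..}. principal {(x, y :: ell2). dist x y < e})"
    by (rule uniformity_ell2_def)
  show "open U \<longleftrightarrow> (\<forall>x\<in>U. \<forall>\<^sub>F (x', y) in uniformity. x' = x \<longrightarrow> y \<in> U)" for U :: "ell2 set"
    by (rule open_ell2_def)
  have Re_inner: "inner x y = (\<Sum>n. Re (cnj (coord x n) * coord y n))" for x y :: ell2
    unfolding inner_ell2_def cinner_def by (rule Re_suminf[OF summable_cnj_mult_coord])
  have summ: "summable (\<lambda>n. Re (cnj (coord x n) * coord y n))" for x y :: ell2
    by (rule summable_Re[OF summable_cnj_mult_coord])
  show "inner x y = inner y x"
    unfolding Re_inner by (simp add: mult.commute)
  show "inner (x + y) z = inner x z + inner y z"
    unfolding Re_inner by (subst suminf_add[OF summ summ]) (simp add: coords algebra_simps)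
  show "inner (r *\<^sub>R x) y = r * inner x y"
    unfolding Re_inner by (subst suminf_mult[OF summ, symmetric]) (simp add: coords algebra_simps)
  have sq: "inner x x = (\<Sum>n. (cmod (coord x n))\<^sup>2)" for x :: ell2
    unfolding Re_inner cmod_power2 by (simp add: power2_eq_square)
  show "0 \<le> inner x x"
    unfolding sq by (intro suminf_nonneg summable_norm_coord) simp
  show "inner x x = 0 \<longleftrightarrow> x = 0"
    unfolding sq by (subst suminf_eq_zero_iff[OF summable_norm_coord])
      (auto intro: ell2_eqI simp: zero_ell2.rep_eq)
qed

end

text \<open>Standard basis vectors; only the indices \<open>n \<ge> 1\<close> are meaningful, and \<open>basis_vec 0 = 0\<close>.\<close>

lift_definition basis_vec :: "nat \<Rightarrow> ell2" is "\<lambda>n m. if m = n \<and> n \<noteq> 0 then 1 else 0"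
  subgoal for n by (auto intro!: summable_finite[of "{n}"] split: if_splits)
  done


section \<open>Trace class operators\<close>

definition bounded_op :: "(ell2 \<Rightarrow> ell2) \<Rightarrow> bool" where
  "bounded_op A \<longleftrightarrow> bounded_linear A \<and> (\<forall>c x. A (cscale c x) = cscale c (A x))"

definition positive_op :: "(ell2 \<Rightarrow> ell2) \<Rightarrow> bool" where
  "positive_op A \<longleftrightarrow> bounded_op A \<and> (\<forall>x. cinner x (A x) \<in> \<real>\<^sub>\<ge>\<^sub>0)"

definition cadjoint :: "(ell2 \<Rightarrow> ell2) \<Rightarrow> ell2 \<Rightarrow> ell2" where
  "cadjoint A = (THE B. \<forall>x y. cinner (A x) y = cinner x (B y))"

text \<open>
  \<open>is_abs_op R A\<close> says that \<open>R\<close> is the absolute value of \<open>A\<close>, i.e. the (unique) positive square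
  root of \<open>A\<^sup>* A\<close>.
\<close>

definition is_abs_op :: "(ell2 \<Rightarrow> ell2) \<Rightarrow> (ell2 \<Rightarrow> ell2) \<Rightarrow> bool" where
  "is_abs_op R A \<longleftrightarrow> positive_op R \<and> R \<circ> R = cadjoint A \<circ> A"

definition trace_class :: "(ell2 \<Rightarrow> ell2) \<Rightarrow> bool" where
  "trace_class A \<longleftrightarrow> bounded_op A \<and>
     (\<exists>R. is_abs_op R A \<and> summable (\<lambda>n. Re (cinner (basis_vec (Suc n)) (R (basis_vec (Suc n))))))"

definition op_trace :: "(ell2 \<Rightarrow> ell2) \<Rightarrow> complex" where
  "op_trace A = (\<Sum>n. cinner (basis_vec (Suc n)) (A (basis_vec (Suc n))))"

definition orth_proj :: "ell2 set \<Rightarrow> ell2 \<Rightarrow> ell2" where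
  "orth_proj S x = (THE y. y \<in> S \<and> (\<forall>s\<in>S. cinner s (x - y) = 0))"


section \<open>The operators of the theorem\<close>

text \<open>At the dummy index 0 the coordinate is \<open>0 / 0 = 0\<close>.\<close>

lift_definition T_op :: "ell2 \<Rightarrow> ell2" is "\<lambda>x n. x n / of_nat n"
  by (auto intro: summable_square_divide_nat)

text \<open>The series converges in norm because \<open>\<Sum>n\<ge>1. \<bar>gregory_coeff n\<bar> = 1\<close>.\<close>

definition u_vec :: ell2 where
  "u_vec = (\<Sum>n. sqrt \<bar>gregory_coeff (Suc n)\<bar> *\<^sub>R basis_vec (Suc n))"

definition Q_op :: "ell2 \<Rightarrow> ell2" where
  "Q_op = orth_proj (range (\<lambda>c. cscale c u_vec))"

definition P_op :: "ell2 \<Rightarrow> ell2" where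
  "P_op x = x - Q_op x"

definition T_perp :: "ell2 \<Rightarrow> ell2" where
  "T_perp = P_op \<circ> T_op \<circ> P_op"

definition power_diff :: "nat \<Rightarrow> ell2 \<Rightarrow> ell2" where
  "power_diff k x = (T_op ^^ k) x - (T_perp ^^ k) x"

definition tau :: "nat \<Rightarrow> complex" where
  "tau k = op_trace (power_diff k)"

end

theory Submission
  imports Defs "HOL-Computational_Algebra.Fundamental_Theorem_Algebra"
begin

text \<open>
  The reflection formula turns \<open>H\<close> into an integral of \<open>\<Gamma>(1 - z) \<Gamma>(x + 1) / \<Gamma>(x + 1 - z)\<close>, and
  expanding the Beta integral gives \<open>H(z) = \<Sum>n\<ge>1. |G\<^sub>n| n / (n - z) = \<langle>u, (1 - z T)\<^sup>-\<^sup>1 u\<rangle>\<close>, so the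
  Taylor coefficients of \<open>H\<close> are the moments \<open>\<langle>u, T\<^sup>k u\<rangle>\<close>. Up to the projection \<open>Q\<close>, the
  resolvents of \<open>T\<close> and \<open>T\<^sub>\<bottom>\<close> differ by a rank one operator; comparing coefficients exhibits \<open>T\<^sup>k - T\<^sub>\<bottom>\<^sup>k\<close> as an
  operator of finite rank whose trace is the \<open>k\<close>-th coefficient of \<open>z H' / H\<close>. The sum over the first
  \<open>N\<close> poles is a rational function with one zero between any two consecutive poles, so its logarithmic
  derivative is a difference of power sums of poles and zeros; letting \<open>N\<close> tend to infinity gives the
  sum over the \<open>\<rho>\<^sub>n\<close>. Finally \<open>\<tau>\<^sub>1 = \<Sum>n. |G\<^sub>n| / n\<close> is the integral of \<open>\<psi>(x + 1) + \<gamma>\<close> over the unit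
  interval.
\<close>

section \<open>Sums of simple poles at the positive integers\<close>

text \<open>Positivity of the weights, before and after integration over x, drives most of the
  argument: it dominates the interchanges of sum and integral, makes H strictly increasing between
  consecutive poles, and gives H positive real part on the unit disc, hence a logarithm. Being trace
  class is a statement about the absolute value of the operator, so finite rank alone does not
  settle it. A symmetric operator of finite rank is annihilated by a real polynomial with simple
  real roots, and its absolute value is then a polynomial in the operator itself, found by
  interpolation instead of diagonalisation. The three claims meet in one real formal power series
  M'/M, with M the moment series: traces, power sums over poles and zeros, and coefficients of log H
  are all read off from it. Working with coefficients reduces the limit over truncations to finitely
  many limits per coefficient. Pairing each pole with the zero in the gap to its right makes the
  errors telescope and so gives a summable bound. The operator part takes the unit norm of u as the
  assumption \<open>sum_G\<close>, which the integral formula for the coefficients supplies at the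
  end.\<close>

definition moment :: "(nat \<Rightarrow> real) \<Rightarrow> nat \<Rightarrow> real" where
  "moment w k = (\<Sum>j. w j / real (Suc j) ^ k)"

definition moment_fps :: "(nat \<Rightarrow> real) \<Rightarrow> real fps" where
  "moment_fps w = Abs_fps (moment w)"

text \<open>The normalisation n / (n - z) = 1 / (1 - z / n) makes the Taylor coefficients at 0 equal
  to the moments.\<close>

definition pole_sum :: "(nat \<Rightarrow> real) \<Rightarrow> complex \<Rightarrow> complex" where
  "pole_sum w z = (\<Sum>j. of_real (w j) * (of_nat (Suc j) / (of_nat (Suc j) - z)))"

abbreviation posnats :: "complex set" where
  "posnats \<equiv> range (\<lambda>j. of_nat (Suc j))"

lemma moment_0: "moment w 0 = suminf w"
  by (simp add: moment_def)

lemma open_Compl_posnats: "open (- posnats)"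
proof -
  have "{1..} = range Suc"
    by (auto simp: image_iff Suc_le_eq gr0_conv_Suc)
  hence "posnats = of_nat ` {1..}" by (simp only: image_image)
  thus ?thesis by (simp add: closed_of_nat_image open_Compl)
qed

text \<open>Since n / (n - y) = 1 + y / (n - y), a positive distance to all poles bounds every
  factor at once. This one bound serves pointwise convergence, the Weierstrass test and the
  interchange with the integral.\<close>

lemma posnats_pole_bounded:
  assumes "z \<notin> posnats"
  obtains d K where "d > 0" "cball z d \<subseteq> - posnats" "K > 0"
    "\<And>y j. y \<in> cball z d \<Longrightarrow> cmod (of_nat (Suc j) / (of_nat (Suc j) - y)) \<le> K"
proof -
  obtain e where e: "e > 0" "cball z e \<subseteq> - posnats"
    using open_Compl_posnats assms open_contains_cball by blast
  \<comment> \<open>Half the radius of a ball free of poles: points within \<open>d\<close> of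
    \<open>z\<close> still keep distance \<open>d\<close> from every pole.\<close>
  define d where "d = e / 2"
  define K where "K = 1 + (cmod z + d) / d"
  have d: "d > 0" "cball z d \<subseteq> cball z e" using e by (auto simp: d_def)
  show ?thesis
  proof (rule that[of d K])
    show "d > 0" "cball z d \<subseteq> - posnats" "K > 0"
      using d e by (auto simp: K_def intro!: add_pos_nonneg)
    fix y j assume y: "y \<in> cball z d"
    let ?n = "of_nat (Suc j) :: complex"
    have "?n \<notin> cball z e" using e by blast
    hence "dist z ?n > e" by simp
    moreover have "dist z ?n \<le> dist z y + dist y ?n" by (rule dist_triangle)
    ultimately have far: "cmod (?n - y) \<ge> d"
      using y by (simp add: d_def dist_norm norm_minus_commute)
    hence "?n - y \<noteq> 0" using d by auto
    hence "?n / (?n - y) = 1 + y / (?n - y)" by (simp add: field_simps)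
    hence "cmod (?n / (?n - y)) \<le> 1 + cmod y / cmod (?n - y)"
      by (metis norm_divide norm_one norm_triangle_ineq)
    also have "cmod y / cmod (?n - y) \<le> (cmod z + d) / d"
    proof (rule frac_le)
      have "cmod y \<le> cmod z + cmod (y - z)" by (metis add.commute diff_add_cancel norm_triangle_ineq)
      thus "cmod y \<le> cmod z + d" using y by (simp add: dist_norm norm_minus_commute)
    qed (use far d in auto)
    finally show "cmod (?n / (?n - y)) \<le> K" by (simp add: K_def)
  qed
qed

lemma notin_posnats_if_norm_less_1:
  assumes "cmod z < 1"
  shows "z \<notin> posnats"
proof
  assume "z \<in> posnats"
  then obtain j where "z = of_nat (Suc j)" by blast
  hence "cmod z = real (Suc j)" by (simp only: norm_of_nat)
  thus False using assms by simp
qed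

locale summable_weights =
  fixes w :: "nat \<Rightarrow> real"
  assumes summable: "summable w" and nonneg: "w j \<ge> 0"
begin

lemma summable_moment: "summable (\<lambda>j. w j / real (Suc j) ^ k)"
proof (rule summable_comparison_test'[OF summable])
  show "norm (w j / real (Suc j) ^ k) \<le> w j" for j
    using nonneg[of j] by (simp add: divide_le_eq mult_le_cancel_left1)
qed

lemma summable_weighted:
  fixes a :: "nat \<Rightarrow> complex"
  assumes "\<And>j. cmod (a j) \<le> K"
  shows "summable (\<lambda>j. of_real (w j) * a j)"
proof (rule summable_comparison_test')
  show "summable (\<lambda>j. w j * K)" by (rule summable_mult2[OF summable])
  show "cmod (of_real (w j) * a j) \<le> w j * K" for j
    using assms[of j] nonneg[of j] by (simp add: norm_mult mult_left_mono)
qed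

lemma pole_sum_sums:
  assumes "z \<notin> posnats"
  shows "(\<lambda>j. of_real (w j) * (of_nat (Suc j) / (of_nat (Suc j) - z))) sums pole_sum w z"
proof -
  obtain d K where "d > 0" "\<And>y j. y \<in> cball z d \<Longrightarrow> cmod (of_nat (Suc j) / (of_nat (Suc j) - y)) \<le> K"
    using posnats_pole_bounded[OF assms] by metis
  hence "cmod (of_nat (Suc j) / (of_nat (Suc j) - z)) \<le> K" for j by auto
  thus ?thesis unfolding pole_sum_def by (intro summable_sums summable_weighted)
qed

lemma pole_sum_holomorphic: "pole_sum w holomorphic_on - posnats"
proof (rule holomorphic_uniform_sequence[OF open_Compl_posnats])
  let ?f = "\<lambda>n z. \<Sum>j<n. complex_of_real (w j) * (of_nat (Suc j) / (of_nat (Suc j) - z))"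
  show "?f n holomorphic_on - posnats" for n
    by (intro holomorphic_intros) auto
  fix z :: complex assume "z \<in> - posnats"
  then obtain d K where dK: "d > 0" "cball z d \<subseteq> - posnats"
    "\<And>y j. y \<in> cball z d \<Longrightarrow> cmod (of_nat (Suc j) / (of_nat (Suc j) - y)) \<le> K"
    using posnats_pole_bounded[of z] by (metis ComplD)
  have "uniform_limit (cball z d) ?f (pole_sum w) sequentially"
    unfolding pole_sum_def
  proof (rule Weierstrass_m_test)
    show "summable (\<lambda>j. w j * K)" by (rule summable_mult2[OF summable])
    show "cmod (of_real (w j) * (of_nat (Suc j) / (of_nat (Suc j) - y))) \<le> w j * K"
      if "y \<in> cball z d" for j y
      unfolding norm_mult using dK(3)[OF that] nonneg[of j] by (simp add: mult_left_mono del: of_nat_Suc)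
  qed
  thus "\<exists>d>0. cball z d \<subseteq> - posnats \<and> uniform_limit (cball z d) ?f (pole_sum w) sequentially"
    using dK by blast
qed

text \<open>The double series is interchanged by hand: summing only K powers commutes with the sum
  over poles, and the geometric remainders add up to at most a constant times
  \<open>cmod z ^ K\<close>.\<close>

lemma pole_sum_power_series:
  assumes z: "cmod z < 1"
  shows "(\<lambda>k. of_real (moment w k) * z ^ k) sums pole_sum w z"
proof -
  define q where "q j = z / of_nat (Suc j)" for j
  have q: "cmod (q j) \<le> cmod z" "cmod (q j) < 1" "q j \<noteq> 1" for j
  proof -
    show "cmod (q j) \<le> cmod z"
      unfolding q_def norm_divide norm_of_nat by (simp add: divide_le_eq mult_le_cancel_left1)
    thus "cmod (q j) < 1" using z by simp
    thus "q j \<noteq> 1" by auto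
  qed
  have z': "z \<notin> posnats" by (rule notin_posnats_if_norm_less_1[OF z])
  have term_eq: "of_nat (Suc j) / (of_nat (Suc j) - z) = 1 / (1 - q j)" for j
    by (simp add: q_def divide_simps del: of_nat_Suc)
  have partial: "(\<lambda>j. of_real (w j) * ((1 - q j ^ K) / (1 - q j))) sums (\<Sum>k<K. of_real (moment w k) * z ^ k)" for K
  proof -
    have "(\<lambda>j. \<Sum>k<K. of_real (w j / real (Suc j) ^ k) * z ^ k) sums (\<Sum>k<K. of_real (moment w k) * z ^ k)"
      unfolding moment_def
      by (intro sums_sum sums_mult2 sums_of_real summable_sums summable_moment)
    moreover have "(\<Sum>k<K. of_real (w j / real (Suc j) ^ k) * z ^ k) = of_real (w j) * ((1 - q j ^ K) / (1 - q j))" for j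
    proof -
      have "(\<Sum>k<K. of_real (w j / real (Suc j) ^ k) * z ^ k) = of_real (w j) * (\<Sum>k<K. q j ^ k)"
        by (simp add: sum_distrib_left q_def power_divide del: of_nat_Suc)
      thus ?thesis using q(3)[of j] by (simp add: sum_gp_strict)
    qed
    ultimately show ?thesis by simp
  qed
  have "(\<lambda>K. (\<Sum>k<K. of_real (moment w k) * z ^ k) - pole_sum w z) \<longlonglongrightarrow> 0"
  proof (rule Lim_null_comparison)
    have "cmod ((\<Sum>k<K. of_real (moment w k) * z ^ k) - pole_sum w z) \<le> suminf w / (1 - cmod z) * cmod z ^ K" for K
    proof -
      have "(\<lambda>j. of_real (w j) * (1 / (1 - q j)) - of_real (w j) * ((1 - q j ^ K) / (1 - q j)))
         sums (pole_sum w z - (\<Sum>k<K. of_real (moment w k) * z ^ k))"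
        using sums_diff[OF pole_sum_sums[OF z'] partial] by (simp only: term_eq)
      hence eq: "pole_sum w z - (\<Sum>k<K. of_real (moment w k) * z ^ k) =
          (\<Sum>j. of_real (w j) * (1 / (1 - q j)) - of_real (w j) * ((1 - q j ^ K) / (1 - q j)))"
        by (rule sums_unique)
      have "cmod (pole_sum w z - (\<Sum>k<K. of_real (moment w k) * z ^ k)) \<le> (\<Sum>j. w j * (cmod z ^ K / (1 - cmod z)))"
        unfolding eq
      proof (rule norm_suminf_le)
        fix j
        have "of_real (w j) * (1 / (1 - q j)) - of_real (w j) * ((1 - q j ^ K) / (1 - q j))
           = of_real (w j) * (q j ^ K / (1 - q j))"
          by (simp add: algebra_simps flip: diff_divide_distrib)
        also have "cmod \<dots> = w j * (cmod (q j) ^ K / cmod (1 - q j))"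
          using nonneg[of j] by (simp add: norm_mult norm_divide norm_power)
        also have "\<dots> \<le> w j * (cmod z ^ K / (1 - cmod z))"
        proof (intro mult_left_mono frac_le power_mono)
          have "1 - cmod (q j) \<le> cmod (1 - q j)"
            using norm_triangle_ineq2[of 1 "q j"] by simp
          thus "1 - cmod z \<le> cmod (1 - q j)" using q(1)[of j] by simp
        qed (use q nonneg z in auto)
        finally show "cmod (of_real (w j) * (1 / (1 - q j)) - of_real (w j) * ((1 - q j ^ K) / (1 - q j)))
            \<le> w j * (cmod z ^ K / (1 - cmod z))" .
      qed (rule summable_mult2[OF summable])
      also have "\<dots> = suminf w / (1 - cmod z) * cmod z ^ K"
        by (subst suminf_mult2[OF summable, symmetric]) simp
      finally show ?thesis by (simp add: norm_minus_commute)
    qed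
    thus "\<forall>\<^sub>F K in sequentially. cmod ((\<Sum>k<K. of_real (moment w k) * z ^ k) - pole_sum w z)
       \<le> suminf w / (1 - cmod z) * cmod z ^ K" by simp
    show "(\<lambda>K. suminf w / (1 - cmod z) * cmod z ^ K) \<longlonglongrightarrow> 0"
      using z by (intro tendsto_mult_right_zero LIMSEQ_power_zero) simp
  qed
  thus ?thesis unfolding sums_def by (rule LIM_zero_cancel)
qed

end

section \<open>Operators on the sequence space\<close>

lemmas coord_simps = plus_ell2.rep_eq zero_ell2.rep_eq uminus_ell2.rep_eq cscale.rep_eq
  T_op.rep_eq

lemma coord_minus: "coord (x - y) n = coord x n - coord y n"
  by (simp only: minus_ell2_def coord_simps) simp

lemma coord_scaleR: "coord (r *\<^sub>R x) n = of_real r * coord x n"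
  by (simp add: scaleR_ell2_def coord_simps)

lemma coord_sum: "coord (\<Sum>i\<in>I. f i) n = (\<Sum>i\<in>I. coord (f i) n)"
  by (induction I rule: infinite_finite_induct) (auto simp: coord_simps)

lemma coord_0 [simp]: "coord x 0 = 0"
  using coord[of x] by simp

lemma cscale_add_left: "cscale (c + d) x = cscale c x + cscale d x"
  and cscale_add_right: "cscale c (x + y) = cscale c x + cscale c y"
  and cscale_diff_right: "cscale c (x - y) = cscale c x - cscale c y"
  and cscale_cscale: "cscale c (cscale d x) = cscale (c * d) x"
  and cscale_one: "cscale 1 x = x"
  and cscale_0_left: "cscale 0 x = 0"
  and cscale_0_right: "cscale c 0 = 0"
  and cscale_scaleR: "cscale c (r *\<^sub>R x) = r *\<^sub>R cscale c x"
  by (auto intro!: ell2_eqI simp: coord_simps coord_minus coord_scaleR algebra_simps)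

lemma cinner_add_right: "cinner x (y + z) = cinner x y + cinner x z"
  unfolding cinner_def
  by (subst suminf_add[OF summable_cnj_mult_coord summable_cnj_mult_coord])
     (simp add: coord_simps algebra_simps)

lemma cinner_cscale_right: "cinner x (cscale c y) = c * cinner x y"
  unfolding cinner_def
  by (subst suminf_mult[OF summable_cnj_mult_coord, symmetric]) (simp add: coord_simps algebra_simps)

lemma cinner_commute: "cnj (cinner x y) = cinner y x"
  unfolding cinner_def
  using bounded_linear.suminf[OF bounded_linear_cnj summable_cnj_mult_coord[of x y]]
  by (simp add: mult.commute)

lemma cinner_add_left: "cinner (x + y) z = cinner x z + cinner y z"
  by (metis cinner_add_right cinner_commute complex_cnj_add)

lemma cinner_cscale_left: "cinner (cscale c x) y = cnj c * cinner x y"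
  by (metis cinner_cscale_right cinner_commute complex_cnj_mult)

lemma cinner_0_left [simp]: "cinner 0 x = 0"
  and cinner_0_right [simp]: "cinner x 0 = 0"
  using cinner_cscale_left[of 0 0 x] cinner_cscale_right[of x 0 0] by (simp_all add: cscale_0_left)

lemma cinner_diff_right: "cinner x (y - z) = cinner x y - cinner x z"
  using cinner_add_right[of x "y - z" z] by simp

lemma cinner_diff_left: "cinner (x - y) z = cinner x z - cinner y z"
  using cinner_add_left[of "x - y" y z] by simp

lemma cinner_scaleR_right: "cinner x (r *\<^sub>R y) = of_real r * cinner x y"
  by (simp add: scaleR_ell2_def cinner_cscale_right)

lemma cinner_scaleR_left: "cinner (r *\<^sub>R x) y = of_real r * cinner x y"
  by (simp add: scaleR_ell2_def cinner_cscale_left)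

lemma cinner_sum_right: "cinner x (\<Sum>i\<in>I. f i) = (\<Sum>i\<in>I. cinner x (f i))"
  by (induction I rule: infinite_finite_induct) (auto simp: cinner_add_right)

lemma cinner_self: "cinner x x = of_real ((norm x)\<^sup>2)"
proof (rule complex_eqI)
  show "Re (cinner x x) = Re (of_real ((norm x)\<^sup>2))"
    by (simp add: power2_norm_eq_inner inner_ell2_def)
  show "Im (cinner x x) = Im (of_real ((norm x)\<^sup>2))"
    using cinner_commute[of x x] by (simp add: complex_eq_iff)
qed

lemma norm_cscale: "norm (cscale c x) = cmod c * norm x"
proof -
  have "complex_of_real ((norm (cscale c x))\<^sup>2) = complex_of_real ((cmod c * norm x)\<^sup>2)"
    unfolding cinner_self[symmetric] cinner_cscale_left cinner_cscale_right
    by (simp add: cinner_self power_mult_distrib mult.assoc[symmetric]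
        complex_norm_square[symmetric] mult.commute[of "cnj c"])
  hence "(norm (cscale c x))\<^sup>2 = (cmod c * norm x)\<^sup>2"
    unfolding of_real_eq_iff .
  thus ?thesis by (simp add: power2_eq_iff_nonneg)
qed

lemma cmod_cinner_le: "cmod (cinner x y) \<le> norm x * norm y"
proof (cases "cinner x y = 0")
  case False
  \<comment> \<open>Rotating \<open>x\<close> by this phase makes the inner product real and
    nonnegative, so the Cauchy-Schwarz inequality of the real inner product applies.\<close>
  define c where "c = sgn (cinner x y)"
  have c: "cmod c = 1" using False by (simp add: c_def norm_sgn)
  have "cinner (cscale c x) y = of_real (cmod (cinner x y))"
    unfolding cinner_cscale_left c_def using False
    by (simp add: sgn_eq complex_norm_square[symmetric] field_simps power2_eq_square
        flip: of_real_mult)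
  hence "cmod (cinner x y) = inner (cscale c x) y"
    by (simp add: inner_ell2_def)
  also have "\<dots> \<le> norm (cscale c x) * norm y"
    by (rule norm_cauchy_schwarz)
  finally show ?thesis by (simp add: norm_cscale c)
qed simp

lemma cinner_basis_vec: "cinner (basis_vec n) x = coord x n"
proof -
  have "(\<lambda>m. cnj (coord (basis_vec n) m) * coord x m) = (\<lambda>m. if m = n then coord x m else 0)"
    by (auto simp: basis_vec.rep_eq)
  thus ?thesis unfolding cinner_def
    using sums_unique[OF sums_single[of n "coord x"]] by simp
qed

lemma cinner_basis_vec': "cinner x (basis_vec n) = cnj (coord x n)"
  by (metis cinner_basis_vec cinner_commute)

lemma cinner_eqI: "(\<And>y. cinner y x = cinner y x') \<Longrightarrow> x = x'"
  by (rule ell2_eqI) (metis cinner_basis_vec)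

lemma norm_ell2_sq: "(\<lambda>n. (cmod (coord x n))\<^sup>2) sums (norm x)\<^sup>2"
proof -
  have "(\<lambda>n. cnj (coord x n) * coord x n) sums of_real ((norm x)\<^sup>2)"
    using summable_sums[OF summable_cnj_mult_coord[of x x]] by (simp add: cinner_def[symmetric] cinner_self)
  hence "(\<lambda>n. complex_of_real ((cmod (coord x n))\<^sup>2)) sums of_real ((norm x)\<^sup>2)"
    by (simp only: complex_norm_square mult.commute)
  thus ?thesis by (simp only: sums_of_real_iff)
qed

section \<open>Bounded and symmetric operators\<close>

lemma bounded_opI:
  assumes "\<And>x y. A (x + y) = A x + A y" "\<And>c x. A (cscale c x) = cscale c (A x)"
    "\<And>x. norm (A x) \<le> K * norm x"
  shows "bounded_op A"
  unfolding bounded_op_def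
proof (intro conjI allI assms)
  show "bounded_linear A"
    by (rule bounded_linear_intro[of _ K])
       (auto simp: assms(1,2) scaleR_ell2_def mult.commute assms(3))
qed

lemma bounded_opD:
  assumes "bounded_op A"
  shows "A (x + y) = A x + A y" "A (cscale c x) = cscale c (A x)" "A (r *\<^sub>R x) = r *\<^sub>R A x"
    "A 0 = 0" "A (x - y) = A x - A y" "A (\<Sum>i\<in>I. f i) = (\<Sum>i\<in>I. A (f i))"
proof -
  interpret bounded_linear A using assms by (simp add: bounded_op_def)
  show "A (x + y) = A x + A y" "A (cscale c x) = cscale c (A x)" "A (r *\<^sub>R x) = r *\<^sub>R A x"
    "A 0 = 0" "A (x - y) = A x - A y" "A (\<Sum>i\<in>I. f i) = (\<Sum>i\<in>I. A (f i))"
    using assms by (auto simp: bounded_op_def add scaleR diff sum zero)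
qed

lemma bounded_op_compose: "bounded_op A \<Longrightarrow> bounded_op B \<Longrightarrow> bounded_op (\<lambda>x. A (B x))"
  unfolding bounded_op_def by (auto intro: bounded_linear_compose)

lemma bounded_op_add: "bounded_op A \<Longrightarrow> bounded_op B \<Longrightarrow> bounded_op (\<lambda>x. A x + B x)"
  unfolding bounded_op_def by (auto intro: bounded_linear_add simp: cscale_add_right)

lemma bounded_op_diff: "bounded_op A \<Longrightarrow> bounded_op B \<Longrightarrow> bounded_op (\<lambda>x. A x - B x)"
  unfolding bounded_op_def by (auto intro: bounded_linear_sub simp: cscale_diff_right)

lemma bounded_op_id: "bounded_op (\<lambda>x. x)"
  unfolding bounded_op_def by simp

lemma bounded_op_zero: "bounded_op (\<lambda>x. 0)"
  unfolding bounded_op_def by (simp add: cscale_0_right)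

lemma bounded_op_scaleR: "bounded_op A \<Longrightarrow> bounded_op (\<lambda>x. r *\<^sub>R A x)"
  unfolding bounded_op_def by (auto intro: bounded_linear_const_scaleR simp: cscale_scaleR)

lemma bounded_op_rank_one: "bounded_op (\<lambda>x. cscale (cinner b x) a)"
  by (rule bounded_opI[of _ "norm b * norm a"])
     (auto simp: cinner_add_right cscale_add_left cinner_cscale_right cscale_cscale norm_cscale
       mult_right_mono cmod_cinner_le
       intro: order_trans[OF mult_right_mono[OF cmod_cinner_le]])

definition symmetric_op :: "(ell2 \<Rightarrow> ell2) \<Rightarrow> bool" where
  "symmetric_op A \<longleftrightarrow> (\<forall>x y. cinner (A x) y = cinner x (A y))"

lemma symmetric_opD: "symmetric_op A \<Longrightarrow> cinner (A x) y = cinner x (A y)"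
  by (simp add: symmetric_op_def)

lemma symmetric_op_funpow: "symmetric_op A \<Longrightarrow> symmetric_op (A ^^ k)"
proof (induction k)
  case (Suc k)
  thus ?case by (simp add: symmetric_op_def funpow_swap1)
qed (simp add: symmetric_op_def)

lemma cadjoint_symmetric_op: "symmetric_op A \<Longrightarrow> cadjoint A = A"
  unfolding cadjoint_def symmetric_op_def
  by (rule the_equality) (auto intro!: ext cinner_eqI)

section \<open>Polynomials in a symmetric operator\<close>

text \<open>Horner evaluation of p(A) x. Real coefficients keep p(A) symmetric whenever A
  is.\<close>

definition poly_op :: "real poly \<Rightarrow> (ell2 \<Rightarrow> ell2) \<Rightarrow> ell2 \<Rightarrow> ell2" where
  "poly_op p A x = fold_coeffs (\<lambda>a y. a *\<^sub>R x + A y) p 0"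

context
  fixes A :: "ell2 \<Rightarrow> ell2"
  assumes A: "bounded_op A"
begin

lemma poly_op_0: "poly_op 0 A x = 0"
  by (simp add: poly_op_def)

lemma poly_op_pCons: "poly_op (pCons a p) A x = a *\<^sub>R x + A (poly_op p A x)"
  by (cases "a = 0 \<and> p = 0") (auto simp: poly_op_def bounded_opD[OF A])

lemma poly_op_add: "poly_op (p + q) A x = poly_op p A x + poly_op q A x"
  by (induction p q rule: poly_induct2)
     (auto simp: poly_op_pCons poly_op_0 bounded_opD[OF A] algebra_simps)

lemma poly_op_smult: "poly_op (smult c p) A x = c *\<^sub>R poly_op p A x"
  by (induction p) (auto simp: poly_op_pCons poly_op_0 bounded_opD[OF A] algebra_simps)

lemma poly_op_diff: "poly_op (p - q) A x = poly_op p A x - poly_op q A x"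
  using poly_op_add[of "p - q" q x] by simp

lemma poly_op_mult: "poly_op (p * q) A x = poly_op p A (poly_op q A x)"
proof (induction p)
  case (pCons a p)
  thus ?case
    by (simp add: poly_op_pCons poly_op_add poly_op_smult mult_pCons_left)
qed (simp add: poly_op_0)

lemma poly_op_commute: "poly_op p A (A x) = A (poly_op p A x)"
  using poly_op_mult[of p "[:0, 1:]" x] poly_op_mult[of "[:0, 1:]" p x]
  by (simp add: poly_op_pCons poly_op_0 bounded_opD[OF A] mult.commute del: mult_pCons_left mult_pCons_right)

lemma poly_op_sum: "poly_op (\<Sum>i\<in>I. p i) A x = (\<Sum>i\<in>I. poly_op (p i) A x)"
  by (induction I rule: infinite_finite_induct) (auto simp: poly_op_0 poly_op_add)

lemma poly_op_monom: "poly_op (monom c n) A x = c *\<^sub>R (A ^^ n) x"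
  by (induction n) (auto simp: monom_0 monom_Suc poly_op_pCons poly_op_0 bounded_opD[OF A])

lemma bounded_op_poly_op: "bounded_op (poly_op p A)"
proof (induction p)
  case 0
  show ?case using bounded_op_zero by (simp add: poly_op_0[abs_def])
next
  case (pCons a p)
  show ?case
    unfolding poly_op_pCons[abs_def]
    by (intro bounded_op_add bounded_op_scaleR bounded_op_id bounded_op_compose[OF A] pCons)
qed

lemma symmetric_op_poly_op:
  assumes "symmetric_op A"
  shows "symmetric_op (poly_op p A)"
proof (induction p)
  case (pCons a p)
  have "cinner (poly_op (pCons a p) A x) y = cinner x (poly_op (pCons a p) A y)" for x y
    by (simp add: poly_op_pCons cinner_add_left cinner_add_right cinner_scaleR_left
        cinner_scaleR_right symmetric_opD[OF assms] symmetric_opD[OF pCons(2)] poly_op_commute)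
  thus ?case by (simp add: symmetric_op_def)
qed (simp add: poly_op_0 symmetric_op_def)

lemma inner_poly_op:
  assumes "symmetric_op A"
  shows "inner (poly_op p A x) y = inner x (poly_op p A y)"
  using symmetric_opD[OF symmetric_op_poly_op[OF assms]] by (simp add: inner_ell2_def)

end

section \<open>Real polynomials: quadratic factors, simple roots, interpolation\<close>

lemma poly_map_poly_of_real: "poly (map_poly complex_of_real p) (of_real a) = of_real (poly p a)"
  by (induction p) (auto simp: map_poly_pCons)

text \<open>The divisor has the roots \<open>z\<close> and its conjugate. A remainder b + c X
  vanishing at a non-real \<open>z\<close> has c = 0 by its imaginary part, and then b = 0.\<close>

lemma real_quadratic_dvd:
  fixes p :: "real poly" and z :: complex
  assumes root: "poly (map_poly of_real p) z = 0" and "Im z \<noteq> 0"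
  shows "[:(cmod z)\<^sup>2, - 2 * Re z, 1:] dvd p"
proof -
  define d where "d = [:(cmod z)\<^sup>2, - 2 * Re z, 1:]"
  define r where "r = p mod d"
  have d: "poly (map_poly of_real d) z = 0"
    unfolding d_def cmod_power2 by (simp add: map_poly_pCons complex_eq_iff algebra_simps power2_eq_square)
  have "map_poly of_real p = map_poly complex_of_real (d * (p div d) + r)"
    by (simp add: r_def)
  also have "\<dots> = map_poly of_real d * map_poly of_real (p div d) + map_poly of_real r"
    by (intro poly_eqI) (simp add: coeff_map_poly coeff_mult)
  finally have r: "poly (map_poly of_real r) z = 0"
    using root d by simp
  have "degree r < 2"
    using degree_mod_less'[of d p] by (cases "r = 0") (auto simp: r_def d_def)
  then obtain b c where bc: "r = [:b, c:]"
    by (metis degree_pCons_eq_if less_2_cases_iff old.nat.inject pCons_cases Suc_inject degree_eq_zeroE One_nat_def nat.distinct(1) pCons_0_0)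
  have "r = 0"
    using r assms(2) unfolding bc by (auto simp: map_poly_pCons complex_eq_iff)
  thus ?thesis unfolding d_def[symmetric] r_def by auto
qed

lemma prod_roots_dvd:
  fixes p :: "real poly"
  assumes "finite S" "\<And>a. a \<in> S \<Longrightarrow> poly p a = 0"
  shows "(\<Prod>a\<in>S. [:- a, 1:]) dvd p"
  using assms
proof (induction S arbitrary: p rule: finite_induct)
  case (insert a S)
  then obtain q where q: "p = [:- a, 1:] * q"
    by (metis dvdE insertI1 poly_eq_0_iff_dvd)
  have "(\<Prod>a\<in>S. [:- a, 1:]) dvd q"
  proof (rule insert.IH)
    fix b assume "b \<in> S"
    with insert(2) insert(4)[of b] show "poly q b = 0" by (auto simp: q)
  qed
  thus ?case using insert by (simp add: q del: mult_pCons_left mult_pCons_right)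
qed simp

lemma real_interpolation:
  fixes f :: "real \<Rightarrow> real"
  assumes "finite S"
  shows "\<exists>p. \<forall>a\<in>S. poly p a = f a"
  using assms
proof (induction S rule: finite_induct)
  case (insert a S)
  then obtain p where p: "\<forall>b\<in>S. poly p b = f b" by blast
  define q where "q = (\<Prod>b\<in>S. [:- b, 1:])"
  have q: "poly q a \<noteq> 0" "\<And>b. b \<in> S \<Longrightarrow> poly q b = 0"
    using insert(1,2) by (auto simp: q_def poly_prod)
  show ?case
    by (rule exI[of _ "p + smult ((f a - poly p a) / poly q a) q"])
       (use p q in auto)
qed simp

text \<open>Symmetry removes non-real roots and repeated roots: \<open>((A - a)\<^sup>2 + b\<^sup>2) y = 0\<close> forces
  \<open>(A - a) y = 0\<close> and \<open>b y = 0\<close>.\<close>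

lemma symmetric_op_annihilator_simple:
  assumes A: "bounded_op A" "symmetric_op A"
    and "q \<noteq> 0" "finite S" "\<And>x. poly_op (q * (\<Prod>a\<in>S. [:- a, 1:])) A x = 0"
  shows "\<exists>S'. finite S' \<and> (\<forall>x. poly_op (\<Prod>a\<in>S'. [:- a, 1:]) A x = 0)"
  using assms(3-5)
proof (induction "degree q" arbitrary: q S rule: less_induct)
  case less
  let ?\<pi> = "\<lambda>S. \<Prod>a\<in>S. [:- a, 1:] :: real poly"
  note mult_pCons_left [simp del] mult_pCons_right [simp del]
  note mult = poly_op_mult[OF A(1)]
  have square: "(norm (poly_op [:- a, 1:] A y))\<^sup>2 = inner (poly_op ([:- a, 1:] * [:- a, 1:]) A y) y" for a y
    by (simp add: mult inner_poly_op[OF A] power2_norm_eq_inner)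
  show ?case
  proof (cases "degree q = 0")
    case True
    then obtain c where c: "q = [:c:]" "c \<noteq> 0"
      using less(2) by (metis degree_eq_zeroE pCons_0_0)
    have "poly_op (?\<pi> S) A x = 0" for x
      using less(4)[of x] c by (simp add: poly_op_smult[OF A(1)] mult_pCons_left)
    thus ?thesis using less(3) by blast
  next
    case False
    have "coeff (map_poly complex_of_real q) (degree q) \<noteq> 0"
      using less(2) by (simp add: coeff_map_poly)
    with False obtain z where z: "poly (map_poly complex_of_real q) z = 0"
      by (metis Fundamental_Theorem_Algebra.fundamental_theorem_of_algebra
          constant_degree degree_map_poly of_real_eq_0_iff)
    show ?thesis
    proof (cases "Im z = 0")
      case False
      obtain q' where q': "q = [:(cmod z)\<^sup>2, - 2 * Re z, 1:] * q'"
        using real_quadratic_dvd[OF z False] by blast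
      have deg: "degree q' < degree q" "q' \<noteq> 0"
        using less(2) by (auto simp: q' degree_mult_eq)
      show ?thesis
      proof (rule less.hyps[OF deg less(3)])
        fix x
        define y where "y = poly_op (q' * ?\<pi> S) A x"
        have eq: "[:(cmod z)\<^sup>2, - 2 * Re z, 1:] = [:- Re z, 1:] * [:- Re z, 1:] + [:(Im z)\<^sup>2:]"
          unfolding cmod_power2 by (simp add: power2_eq_square mult_pCons_left)
        have "0 = inner (poly_op [:(cmod z)\<^sup>2, - 2 * Re z, 1:] A y) y"
          using less(4)[of x] by (simp only: q' mult.assoc mult y_def inner_zero_left)
        also have "\<dots> = (norm (poly_op [:- Re z, 1:] A y))\<^sup>2 + (Im z)\<^sup>2 * (norm y)\<^sup>2"
        proof -
          have "poly_op [:(Im z)\<^sup>2:] A y = (Im z)\<^sup>2 *\<^sub>R y"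
            by (simp add: poly_op_pCons[OF A(1)] poly_op_0[OF A(1)] bounded_opD[OF A(1)])
          thus ?thesis
            by (simp only: eq poly_op_add[OF A(1)] inner_add_left square[symmetric]
                inner_scaleR_left power2_norm_eq_inner[of y])
        qed
        finally have "(Im z)\<^sup>2 * (norm y)\<^sup>2 = 0"
          by (metis add_nonneg_eq_0_iff zero_le_mult_iff zero_le_power2)
        thus "poly_op (q' * ?\<pi> S) A x = 0"
          using False by (simp add: y_def)
      qed
    next
      case True
      define a where "a = Re z"
      have "z = of_real a" using True by (simp add: a_def complex_eq_iff)
      hence "poly q a = 0"
        using z by (simp add: poly_map_poly_of_real)
      then obtain q' where q': "q = [:- a, 1:] * q'"
        by (metis dvdE poly_eq_0_iff_dvd)
      have deg: "degree q' < degree q" "q' \<noteq> 0"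
        using less(2) by (auto simp: q' degree_mult_eq)
      show ?thesis
      \<comment> \<open>A new root moves from \<open>q\<close> into \<open>S\<close>. A root already
        in \<open>S\<close> occurs twice in the full product, and symmetry allows one copy to be
        dropped. Either way the degree of \<open>q\<close> falls.\<close>
      proof (cases "a \<in> S")
        case False
        show ?thesis
        proof (rule less.hyps[OF deg])
          show "finite (insert a S)" using less(3) by simp
          fix x
          have "q' * ?\<pi> (insert a S) = q * ?\<pi> S"
            using False less(3) by (simp add: q' mult_ac)
          thus "poly_op (q' * ?\<pi> (insert a S)) A x = 0"
            using less(4) by simp
        qed
      next
        case True
        show ?thesis
        proof (rule less.hyps[OF deg less(3)])
          fix x
          define y where "y = poly_op (q' * ?\<pi> (S - {a})) A x"
          have S: "?\<pi> S = [:- a, 1:] * ?\<pi> (S - {a})"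
            using True less(3) by (simp add: prod.remove)
          have "q * ?\<pi> S = ([:- a, 1:] * [:- a, 1:]) * (q' * ?\<pi> (S - {a}))"
            by (simp add: q' S mult_ac)
          hence "poly_op ([:- a, 1:] * [:- a, 1:]) A y = 0"
            using less(4)[of x] by (simp only: y_def mult[symmetric])
          hence "poly_op [:- a, 1:] A y = 0"
            using square[of a y] by simp
          moreover have "q' * ?\<pi> S = [:- a, 1:] * (q' * ?\<pi> (S - {a}))"
            by (simp add: S mult_ac)
          ultimately show "poly_op (q' * ?\<pi> S) A x = 0"
            by (simp only: mult y_def)
        qed
      qed
    qed
  qed
qed

section \<open>Annihilating polynomials of operators of finite rank\<close>

lemma finite_span_annihilator:
  assumes A: "bounded_op A" and B: "finite B" "range A \<subseteq> span B" and a: "a \<in> span B"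
  shows "\<exists>p. p \<noteq> 0 \<and> poly_op p A a = 0"
proof -
  \<comment> \<open>The Krylov sequence of \<open>a\<close>. Its first \<open>card B + 1\<close>
    members lie in the span of \<open>B\<close>, and a linear relation among them is a polynomial in
    \<open>A\<close> that kills \<open>a\<close>.\<close>
  define v where "v j = (A ^^ j) a" for j
  have v: "v j \<in> span B" for j
    using a B(2) by (cases j) (auto simp: v_def)
  show ?thesis
  \<comment> \<open>Linear dependence is a property of sets, which would hide a repeated iterate; a
    repetition gives the polynomial X^i - X^j directly.\<close>
  proof (cases "inj v")
    case False
    then obtain i j where ij: "v i = v j" "i \<noteq> j" by (auto simp: inj_def)
    have "monom 1 i - monom 1 j \<noteq> (0 :: real poly)"
      using ij(2) by (auto simp: monom_eq_iff')
    moreover have "poly_op (monom 1 i - monom 1 j) A a = 0"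
      using ij(1) by (simp add: poly_op_diff[OF A] poly_op_monom[OF A] v_def)
    ultimately show ?thesis by blast
  next
    case True
    let ?I = "{..card B}"
    have inj: "inj_on v ?I" using True by (rule inj_on_subset) simp
    have "\<not> independent (v ` ?I)"
    proof
      assume "independent (v ` ?I)"
      from independent_span_bound[OF B(1) this] v have "card (v ` ?I) \<le> card B" by blast
      thus False using inj by (simp add: card_image)
    qed
    then obtain c w where c: "w \<in> v ` ?I" "c w \<noteq> 0" "(\<Sum>x\<in>v ` ?I. c x *\<^sub>R x) = 0"
      using dependent_finite[of "v ` ?I"] by auto
    define p where "p = (\<Sum>j\<in>?I. monom (c (v j)) j)"
    obtain j where j: "j \<le> card B" "w = v j" using c(1) by auto
    have "coeff p j = c w"
      using j by (simp add: p_def coeff_sum sum.delta)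
    hence "p \<noteq> 0" using c(2) by auto
    moreover have "poly_op p A a = 0"
      using c(3) inj unfolding sum.reindex[OF inj]
      by (simp add: p_def poly_op_sum[OF A] poly_op_monom[OF A] v_def)
    ultimately show ?thesis by blast
  qed
qed

text \<open>The product of polynomials killing the single vectors \<open>a i\<close> kills the range
  of \<open>A\<close>; one further factor X kills the whole space.\<close>

lemma finite_rank_annihilator:
  assumes A: "bounded_op A" and I: "finite I" and rep: "\<And>x. A x = (\<Sum>i\<in>I. cscale (c i x) (a i))"
  shows "\<exists>p. p \<noteq> 0 \<and> (\<forall>x. poly_op p A x = 0)"
proof -
  \<comment> \<open>\<open>span\<close> is taken over the reals, so complex multiples of
    \<open>a i\<close> need the second generator.\<close>
  define B where "B = a ` I \<union> (\<lambda>i. cscale \<i> (a i)) ` I"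
  have B: "finite B" using I by (simp add: B_def)
  have "cscale z (a i) \<in> span B" if "i \<in> I" for z i
  proof -
    have "cscale z (a i) = Re z *\<^sub>R a i + Im z *\<^sub>R cscale \<i> (a i)"
      by (rule ell2_eqI) (simp add: coord_simps coord_scaleR complex_eq_iff)
    also have "\<dots> \<in> span B"
      using that by (intro span_add span_scale span_base) (auto simp: B_def)
    finally show ?thesis .
  qed
  hence ran: "range A \<subseteq> span B" unfolding rep by (auto intro: span_sum)
  have "\<exists>p. p \<noteq> 0 \<and> poly_op p A (a i) = 0" if "i \<in> I" for i
    by (rule finite_span_annihilator[OF A B ran]) (use that in \<open>auto simp: B_def intro: span_base\<close>)
  then obtain p where p: "\<And>i. i \<in> I \<Longrightarrow> p i \<noteq> 0 \<and> poly_op (p i) A (a i) = 0" by metis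
  define q where "q = prod p I"
  have "poly_op q A (a i) = 0" if "i \<in> I" for i
  proof -
    have "q = prod p (I - {i}) * p i"
      using I that by (simp add: q_def prod.remove mult.commute)
    thus ?thesis using p[OF that]
      by (simp add: poly_op_mult[OF A] bounded_opD[OF bounded_op_poly_op[OF A]])
  qed
  hence "poly_op q A (A x) = 0" for x
    by (subst rep) (simp add: bounded_opD[OF bounded_op_poly_op[OF A]] cscale_0_right)
  hence "poly_op (pCons 0 q) A x = 0" for x
    by (simp add: poly_op_pCons[OF A] poly_op_commute[OF A])
  moreover have "pCons 0 q \<noteq> 0" using p I by (simp add: q_def)
  ultimately show ?thesis by blast
qed

section \<open>Trace class membership and trace in finite rank\<close>

lemma summable_norm_rank_one:
  "summable (\<lambda>n. (norm (cscale (cinner b (basis_vec (Suc n))) a))\<^sup>2)"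
proof -
  have "summable (\<lambda>n. (norm a)\<^sup>2 * (cmod (coord b (Suc n)))\<^sup>2)"
    using summable_norm_coord[of b] by (intro summable_mult) (subst summable_Suc_iff)
  thus ?thesis
    by (simp add: norm_cscale cinner_basis_vec' power_mult_distrib mult.commute)
qed

lemma summable_norm_square_sum:
  fixes f :: "'i \<Rightarrow> nat \<Rightarrow> 'a :: real_inner"
  assumes "finite I" "\<And>i. i \<in> I \<Longrightarrow> summable (\<lambda>n. (norm (f i n))\<^sup>2)"
  shows "summable (\<lambda>n. (norm (\<Sum>i\<in>I. f i n))\<^sup>2)"
  using assms
proof (induction I rule: finite_induct)
  case (insert i I)
  have "(norm (x + y))\<^sup>2 \<le> 2 * (norm x)\<^sup>2 + 2 * (norm y)\<^sup>2" for x y :: 'a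
  proof -
    have "(norm (x + y))\<^sup>2 \<le> (norm x + norm y)\<^sup>2"
      by (intro power_mono norm_triangle_ineq) simp
    thus ?thesis using sum_squares_bound[of "norm x" "norm y"] by (simp add: power2_sum)
  qed
  moreover have "summable (\<lambda>n. 2 * (norm (f i n))\<^sup>2 + 2 * (norm (\<Sum>i\<in>I. f i n))\<^sup>2)"
    using insert by (intro summable_add summable_mult) auto
  ultimately show ?case
    using insert(1,2) by (intro summable_comparison_test'[OF \<open>summable (\<lambda>n. 2 * _ n + _ n)\<close>]) auto
qed simp

text \<open>The absolute value is R = s(A)^2, where the real polynomial s takes the value sqrt |l|
  at each root l of a squarefree annihilator. Then s^4 - X^2 vanishes at these roots, so R R = A A,
  and R is positive because \<langle>x, R x\<rangle> is the squared norm of s(A) x.\<close>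

lemma trace_class_symmetric_finite_rank:
  assumes sym: "symmetric_op A" and I: "finite I"
    and rep: "\<And>x. A x = (\<Sum>i\<in>I. cscale (cinner (b i) x) (a i))"
  shows "trace_class A"
proof -
  have A: "bounded_op A"
  proof -
    have "bounded_op (\<lambda>x. \<Sum>i\<in>I. cscale (cinner (b i) x) (a i))"
      using I by (induction I rule: finite_induct) (simp_all add: bounded_op_zero bounded_op_add bounded_op_rank_one)
    thus ?thesis by (simp add: rep[abs_def])
  qed
  obtain q where "q \<noteq> 0" "\<And>x. poly_op q A x = 0"
    using finite_rank_annihilator[OF A I rep] by blast
  then obtain S where S: "finite S" "\<And>x. poly_op (\<Prod>a\<in>S. [:- a, 1:]) A x = 0"
    using symmetric_op_annihilator_simple[OF A sym, of q "{}"] by auto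
  \<comment> \<open>The node 0 is added to make s divisible by X: the norm of s(A) e_n is then
    bounded by a multiple of that of A e_n, whose squares are summable.\<close>
  obtain s where s: "\<And>l. l \<in> insert 0 S \<Longrightarrow> poly s l = sqrt \<bar>l\<bar>"
    using real_interpolation[of "insert 0 S" "\<lambda>l. sqrt \<bar>l\<bar>"] S(1) by blast
  define R where "R = poly_op (s * s) A"
  have RR: "R (R x) = A (A x)" for x
  proof -
    have "(\<Prod>a\<in>S. [:- a, 1:]) dvd (s * s) * (s * s) - [:0, 1:] * [:0, 1:]"
    proof (rule prod_roots_dvd[OF S(1)])
      fix l assume "l \<in> S"
      hence "poly s l = sqrt \<bar>l\<bar>" using s by simp
      thus "poly ((s * s) * (s * s) - [:0, 1:] * [:0, 1:]) l = 0" by simp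
    qed
    then obtain r where "(s * s) * (s * s) - [:0, 1:] * [:0, 1:] = r * (\<Prod>a\<in>S. [:- a, 1:])"
      by (metis dvdE mult.commute)
    hence "poly_op ((s * s) * (s * s) - [:0, 1:] * [:0, 1:]) A x = poly_op r A 0"
      by (simp only: poly_op_mult[OF A] S(2))
    hence "poly_op ((s * s) * (s * s)) A x = poly_op ([:0, 1:] * [:0, 1:]) A x"
      by (simp add: poly_op_diff[OF A] bounded_opD[OF bounded_op_poly_op[OF A]]
          del: mult_pCons_left mult_pCons_right)
    hence "R (R x) = poly_op [:0, 1:] A (poly_op [:0, 1:] A x)"
      unfolding R_def by (simp only: poly_op_mult[OF A])
    thus ?thesis
      by (simp add: poly_op_pCons[OF A] poly_op_0[OF A] bounded_opD[OF A])
  qed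
  have cR: "cinner x (R x) = of_real ((norm (poly_op s A x))\<^sup>2)" for x
    by (simp only: R_def poly_op_mult[OF A] cinner_self[symmetric]
        symmetric_opD[OF symmetric_op_poly_op[OF A sym]])
  have "is_abs_op R A"
    unfolding is_abs_op_def positive_op_def
    by (auto simp: cadjoint_symmetric_op[OF sym] cR RR) (simp add: R_def bounded_op_poly_op[OF A])
  moreover have "summable (\<lambda>n. Re (cinner (basis_vec (Suc n)) (R (basis_vec (Suc n)))))"
  proof -
    have "poly s 0 = 0" using s[of 0] by simp
    then obtain t where t: "s = t * [:0, 1:]"
      by (metis dvdE mult.commute poly_eq_0_iff_dvd neg_equal_zero)
    obtain K where K: "\<And>x. norm (poly_op t A x) \<le> norm x * K"
      using bounded_op_poly_op[OF A, of t] unfolding bounded_op_def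
      by (meson bounded_linear.bounded)
    have "poly_op s A x = poly_op t A (A x)" for x
      unfolding t poly_op_mult[OF A] by (simp add: poly_op_pCons[OF A] poly_op_0[OF A] bounded_opD[OF A])
    hence le: "(norm (poly_op s A x))\<^sup>2 \<le> K\<^sup>2 * (norm (A x))\<^sup>2" for x
      using power_mono[OF K[of "A x"], of 2] by (simp add: power_mult_distrib mult.commute)
    have "summable (\<lambda>n. (norm (A (basis_vec (Suc n))))\<^sup>2)"
      unfolding rep by (intro summable_norm_square_sum I summable_norm_rank_one)
    hence "summable (\<lambda>n. K\<^sup>2 * (norm (A (basis_vec (Suc n))))\<^sup>2)"
      by (rule summable_mult)
    thus ?thesis
      unfolding cR Re_complex_of_real by (rule summable_comparison_test') (use le in auto)
  qed
  ultimately show ?thesis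
    unfolding trace_class_def using A by blast
qed

lemma trace_finite_rank:
  assumes "finite I" and rep: "\<And>x. A x = (\<Sum>i\<in>I. cscale (cinner (b i) x) (a i))"
  shows "op_trace A = (\<Sum>i\<in>I. cinner (b i) (a i))"
proof -
  have "(\<lambda>n. cnj (coord (b i) (Suc n)) * coord (a i) (Suc n)) sums cinner (b i) (a i)" for i
    using summable_sums[OF summable_cnj_mult_coord[of "b i" "a i"]]
    by (subst sums_Suc_iff) (simp add: cinner_def)
  hence "(\<lambda>n. \<Sum>i\<in>I. cnj (coord (b i) (Suc n)) * coord (a i) (Suc n)) sums (\<Sum>i\<in>I. cinner (b i) (a i))"
    by (rule sums_sum)
  thus ?thesis
    unfolding op_trace_def rep
    by (simp add: cinner_basis_vec cinner_basis_vec' coord_sum coord_simps sums_unique[symmetric])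
qed

section \<open>The compression of \<open>T\<close>\<close>

lemma bounded_op_T: "bounded_op T_op"
proof (rule bounded_opI[of _ 1])
  fix x
  have "(norm (T_op x))\<^sup>2 \<le> (norm x)\<^sup>2"
  proof (rule sums_le[OF _ norm_ell2_sq norm_ell2_sq])
    show "(cmod (coord (T_op x) n))\<^sup>2 \<le> (cmod (coord x n))\<^sup>2" for n
      by (cases "n = 0")
         (auto simp: coord_simps norm_divide divide_le_eq mult_le_cancel_left1 intro!: power_mono)
  qed
  thus "norm (T_op x) \<le> 1 * norm x" by (simp add: power2_le_iff_abs_le)
qed (auto intro!: ell2_eqI simp: coord_simps add_divide_distrib)

lemma symmetric_op_T: "symmetric_op T_op"
  by (auto simp: symmetric_op_def cinner_def coord_simps)

lemma coord_T_funpow: "coord ((T_op ^^ k) x) n = coord x n / of_nat n ^ k"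
  by (induction k) (auto simp: coord_simps divide_simps)

context
  assumes sum_G: "(\<lambda>j. \<bar>gregory_coeff (Suc j)\<bar>) sums 1"
begin

abbreviation (input) "abs_gregory_coeffs \<equiv> \<lambda>j. \<bar>gregory_coeff (Suc j)\<bar>"

lemma coord_u_vec: "coord u_vec (Suc n) = of_real (sqrt (abs_gregory_coeffs n))"
proof -
  define f where "f n = (if n = 0 then 0 else complex_of_real (sqrt \<bar>gregory_coeff n\<bar>))" for n
  \<comment> \<open>\<open>u_vec\<close> is a norm limit. The candidate is given by its coordinates,
    and its squared distance from the N-th partial sum is a tail of the series in
    \<open>sum_G\<close>.\<close>
  define U where "U = Abs_ell2 f"
  have "summable (\<lambda>n. (cmod (f n))\<^sup>2)"
    using sum_G by (subst summable_Suc_iff[symmetric]) (simp add: f_def sums_iff)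
  hence U: "coord U = f"
    unfolding U_def by (subst Abs_ell2_inverse) (auto simp: f_def)
  have coord_part: "coord (\<Sum>n<N. sqrt (abs_gregory_coeffs n) *\<^sub>R basis_vec (Suc n)) m = (if m \<le> N then f m else 0)" for N m
  proof -
    have "coord (\<Sum>n<N. sqrt (abs_gregory_coeffs n) *\<^sub>R basis_vec (Suc n)) m
       = (\<Sum>n<N. if m = Suc n then f m else 0)"
      by (auto simp: coord_sum coord_scaleR basis_vec.rep_eq f_def intro!: sum.cong)
    also have "\<dots> = (if m \<le> N then f m else 0)"
    proof (cases m)
      case (Suc l)
      have "(\<Sum>n<N. if m = Suc n then f m else 0) = (\<Sum>n<N. if n = l then f m else 0)"
        using Suc by (intro sum.cong) auto
      thus ?thesis using Suc by (simp add: Suc_le_eq)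
    qed (simp add: f_def)
    finally show ?thesis .
  qed
  have "(\<lambda>n. sqrt (abs_gregory_coeffs n) *\<^sub>R basis_vec (Suc n)) sums U"
    unfolding sums_def
  proof (rule LIM_zero_cancel, rule tendsto_norm_zero_cancel)
    let ?D = "\<lambda>N. (\<Sum>n<N. sqrt (abs_gregory_coeffs n) *\<^sub>R basis_vec (Suc n)) - U"
    have eq: "(norm (?D N))\<^sup>2 = 1 - (\<Sum>n<N. abs_gregory_coeffs n)" for N
    proof -
      have "(\<lambda>m. (cmod (coord (?D N) m))\<^sup>2) = (\<lambda>m. if m \<le> N then 0 else \<bar>gregory_coeff m\<bar>)"
        by (auto simp: coord_minus coord_part U f_def)
      hence "(\<lambda>m. if m \<le> N then 0 else \<bar>gregory_coeff m\<bar>) sums (norm (?D N))\<^sup>2"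
        using norm_ell2_sq[of "?D N"] by simp
      hence tail: "(\<lambda>m. if Suc m \<le> N then 0 else abs_gregory_coeffs m) sums (norm (?D N))\<^sup>2"
        using sums_Suc_iff[of "\<lambda>m. if m \<le> N then 0 else \<bar>gregory_coeff m\<bar>"] by simp
      have "(\<lambda>m. abs_gregory_coeffs m - (if m \<in> {..<N} then abs_gregory_coeffs m else 0)) sums (1 - (\<Sum>n<N. abs_gregory_coeffs n))"
        by (intro sums_diff sum_G sums_If_finite_set) simp
      moreover have "(\<lambda>m. abs_gregory_coeffs m - (if m \<in> {..<N} then abs_gregory_coeffs m else 0)) = (\<lambda>m. if Suc m \<le> N then 0 else abs_gregory_coeffs m)"
        by auto
      ultimately show ?thesis using sums_unique2[OF tail] by simp
    qed
    have "(\<lambda>N. 1 - (\<Sum>n<N. abs_gregory_coeffs n)) \<longlonglongrightarrow> 1 - 1"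
      using sum_G unfolding sums_def by (intro tendsto_intros)
    hence "(\<lambda>N. sqrt ((norm (?D N))\<^sup>2)) \<longlonglongrightarrow> sqrt 0"
      unfolding eq by (intro tendsto_real_sqrt) simp
    thus "(\<lambda>N. norm (?D N)) \<longlonglongrightarrow> 0" by simp
  qed
  hence "coord u_vec = f" by (simp add: u_vec_def sums_iff U)
  thus ?thesis by (simp add: f_def)
qed

lemma cinner_T_powers_u: "cinner ((T_op ^^ a) u_vec) ((T_op ^^ b) u_vec) = of_real (moment abs_gregory_coeffs (a + b))"
proof -
  have "(\<lambda>n. cnj (coord ((T_op ^^ a) u_vec) (Suc n)) * coord ((T_op ^^ b) u_vec) (Suc n))
      = (\<lambda>n. complex_of_real (abs_gregory_coeffs n / real (Suc n) ^ (a + b)))"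
  proof
    fix n
    have "coord ((T_op ^^ k) u_vec) (Suc n) = of_real (sqrt (abs_gregory_coeffs n) / real (Suc n) ^ k)" for k
      by (simp add: coord_T_funpow coord_u_vec)
    thus "cnj (coord ((T_op ^^ a) u_vec) (Suc n)) * coord ((T_op ^^ b) u_vec) (Suc n)
        = complex_of_real (abs_gregory_coeffs n / real (Suc n) ^ (a + b))"
      by (simp only: complex_cnj_complex_of_real of_real_mult[symmetric] power_add) simp
  qed
  moreover have "(\<lambda>n. complex_of_real (abs_gregory_coeffs n / real (Suc n) ^ (a + b))) sums of_real (moment abs_gregory_coeffs (a + b))"
    unfolding moment_def sums_of_real_iff
    by (intro summable_sums summable_weights.summable_moment) (unfold_locales, use sum_G in \<open>auto simp: sums_iff\<close>)
  ultimately have "(\<lambda>n. cnj (coord ((T_op ^^ a) u_vec) n) * coord ((T_op ^^ b) u_vec) n) sums of_real (moment abs_gregory_coeffs (a + b))"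
    using sums_Suc_iff[of "\<lambda>n. cnj (coord ((T_op ^^ a) u_vec) n) * coord ((T_op ^^ b) u_vec) n"]
    by simp
  thus ?thesis by (simp add: cinner_def sums_iff)
qed

lemma moment_w_0: "moment abs_gregory_coeffs 0 = 1"
  using sum_G by (simp add: moment_0 sums_iff)

lemma cinner_u_u: "cinner u_vec u_vec = 1"
  using cinner_T_powers_u[of 0 0] by (simp add: moment_w_0)

lemma Q_op_eq: "Q_op x = cscale (cinner u_vec x) u_vec"
  unfolding Q_op_def orth_proj_def
proof (rule the_equality)
  show "cscale (cinner u_vec x) u_vec \<in> range (\<lambda>c. cscale c u_vec) \<and>
    (\<forall>s\<in>range (\<lambda>c. cscale c u_vec). cinner s (x - cscale (cinner u_vec x) u_vec) = 0)"
    by (auto simp: cinner_cscale_left cinner_diff_right cinner_cscale_right cinner_u_u)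
next
  fix y
  assume y: "y \<in> range (\<lambda>c. cscale c u_vec) \<and> (\<forall>s\<in>range (\<lambda>c. cscale c u_vec). cinner s (x - y) = 0)"
  then obtain c where c: "y = cscale c u_vec" by auto
  have "cinner (cscale 1 u_vec) (x - y) = 0" using y by blast
  thus "y = cscale (cinner u_vec x) u_vec"
    by (simp add: c cscale_one cinner_diff_right cinner_cscale_right cinner_u_u)
qed

lemma P_op_eq: "P_op x = x - cscale (cinner u_vec x) u_vec"
  by (simp add: P_op_def Q_op_eq)

lemma bounded_op_P: "bounded_op P_op"
  unfolding P_op_eq[abs_def] by (intro bounded_op_diff bounded_op_id bounded_op_rank_one)

lemma symmetric_op_P: "symmetric_op P_op"
  unfolding symmetric_op_def P_op_eq
  by (simp add: cinner_diff_left cinner_diff_right cinner_cscale_left cinner_cscale_right cinner_commute)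

lemma P_op_P_op: "P_op (P_op x) = P_op x"
  by (simp add: P_op_eq cinner_diff_right cinner_cscale_right cinner_u_u cscale_0_left)

lemma P_op_u: "P_op u_vec = 0"
  by (simp add: P_op_eq cinner_u_u cscale_one)

lemma T_perp_eq: "T_perp x = P_op (T_op (P_op x))"
  by (simp add: T_perp_def)

lemma symmetric_op_T_perp: "symmetric_op T_perp"
  unfolding symmetric_op_def T_perp_eq
  by (simp add: symmetric_opD[OF symmetric_op_P] symmetric_opD[OF symmetric_op_T])

lemma symmetric_op_power_diff: "symmetric_op (power_diff k)"
  unfolding symmetric_op_def power_diff_def
  by (simp add: cinner_diff_left cinner_diff_right
      symmetric_opD[OF symmetric_op_funpow[OF symmetric_op_T]]
      symmetric_opD[OF symmetric_op_funpow[OF symmetric_op_T_perp]])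

text \<open>Coefficients of the resolvent identity
  \<open>(1 - z T)\<^sup>-\<^sup>1 - (1 - z T\<^sub>\<bottom>)\<^sup>-\<^sup>1 P = R u (R u)\<^sup>* / \<langle>u, R u\<rangle>\<close> with \<open>R = (1 - z T)\<^sup>-\<^sup>1\<close>, where
  \<open>\<langle>u, R u\<rangle>\<close> is the moment series: \<open>resolvent_vec j\<close> is the \<open>j\<close>-th coefficient of
  \<open>R u / \<langle>u, R u\<rangle>\<close>.\<close>

definition resolvent_vec :: "nat \<Rightarrow> ell2" where
  "resolvent_vec j =
     (\<Sum>a\<le>j. fps_nth (inverse (moment_fps abs_gregory_coeffs)) (j - a) *\<^sub>R (T_op ^^ a) u_vec)"

lemma resolvent_vec_0: "resolvent_vec 0 = u_vec"
  by (simp add: resolvent_vec_def moment_fps_def moment_w_0)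

lemma moment_fps_mult_inverse: "moment_fps abs_gregory_coeffs * inverse (moment_fps abs_gregory_coeffs) = 1"
  by (rule inverse_mult_eq_1') (simp add: moment_fps_def moment_w_0)

text \<open>These are the coefficients of \<langle>u, R u\<rangle> / \<langle>u, R u\<rangle> = 1.
  Hence all vectors of positive index lie in the range of \<open>P_op\<close>.\<close>

lemma cinner_u_resolvent_vec: "cinner u_vec (resolvent_vec j) = (if j = 0 then 1 else 0)"
proof -
  have "cinner u_vec (resolvent_vec j) =
      of_real (\<Sum>a\<le>j. fps_nth (inverse (moment_fps abs_gregory_coeffs)) (j - a) * moment abs_gregory_coeffs a)"
    using cinner_T_powers_u[of 0]
    by (simp add: resolvent_vec_def cinner_sum_right cinner_scaleR_right)
  also have "(\<Sum>a\<le>j. fps_nth (inverse (moment_fps abs_gregory_coeffs)) (j - a) * moment abs_gregory_coeffs a)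
      = fps_nth (moment_fps abs_gregory_coeffs * inverse (moment_fps abs_gregory_coeffs)) j"
    unfolding fps_mult_nth atLeast0AtMost by (simp add: moment_fps_def mult.commute)
  finally show ?thesis by (simp add: moment_fps_mult_inverse)
qed

lemma P_op_resolvent_vec: "P_op (resolvent_vec j) = (if j = 0 then 0 else resolvent_vec j)"
  using P_op_u by (auto simp: P_op_eq cinner_u_resolvent_vec resolvent_vec_0 cscale_0_left cinner_u_u cscale_one)

lemma T_op_resolvent_vec:
  "T_op (resolvent_vec j) =
     resolvent_vec (Suc j) - fps_nth (inverse (moment_fps abs_gregory_coeffs)) (Suc j) *\<^sub>R u_vec"
proof -
  have "resolvent_vec (Suc j) = fps_nth (inverse (moment_fps abs_gregory_coeffs)) (Suc j) *\<^sub>R u_vec +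
     (\<Sum>a\<le>j. fps_nth (inverse (moment_fps abs_gregory_coeffs)) (j - a) *\<^sub>R T_op ((T_op ^^ a) u_vec))"
    unfolding resolvent_vec_def by (subst sum.atMost_Suc_shift) simp
  thus ?thesis
    by (simp add: resolvent_vec_def bounded_opD[OF bounded_op_T])
qed

text \<open>\<open>T_op\<close> raises the index up to a multiple of \<open>u_vec\<close>, which the
  projection kills. This is the recursion that closes the induction for the powers of
  \<open>T_perp\<close>.\<close>

lemma P_T_resolvent_vec: "P_op (T_op (resolvent_vec j)) = resolvent_vec (Suc j)"
  by (simp add: T_op_resolvent_vec bounded_opD[OF bounded_op_P] P_op_u P_op_resolvent_vec)

text \<open>The k-th coefficient, a Cauchy product, of the rank one right-hand side of the resolvent
  identity.\<close>

definition resolvent_diff :: "nat \<Rightarrow> ell2 \<Rightarrow> ell2" where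
  "resolvent_diff k x =
     (\<Sum>b\<le>k. cscale (cinner ((T_op ^^ b) u_vec) x) (resolvent_vec (k - b)))"

lemma T_perp_funpow_P: "(T_perp ^^ k) (P_op x) = (T_op ^^ k) x - resolvent_diff k x"
proof -
  \<comment> \<open>Invariance under \<open>P_op\<close> is carried along: it absorbs the inner
    projection when \<open>T_perp\<close> is applied once more.\<close>
  have "(T_perp ^^ k) (P_op x) = (T_op ^^ k) x - resolvent_diff k x \<and>
    P_op ((T_perp ^^ k) (P_op x)) = (T_perp ^^ k) (P_op x)"
  proof (induction k)
    case 0
    show ?case by (simp add: P_op_P_op resolvent_diff_def resolvent_vec_0) (simp add: P_op_eq)
  next
    case (Suc k)
    have "(T_perp ^^ Suc k) (P_op x) = P_op (T_op ((T_op ^^ k) x - resolvent_diff k x))"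
    proof -
      have "(T_perp ^^ Suc k) (P_op x) = P_op (T_op (P_op ((T_perp ^^ k) (P_op x))))"
        by (simp add: T_perp_eq[of "(T_perp ^^ k) _"])
      thus ?thesis unfolding conjunct2[OF Suc] unfolding conjunct1[OF Suc] .
    qed
    also have "\<dots> = P_op ((T_op ^^ Suc k) x) -
        (\<Sum>b\<le>k. cscale (cinner ((T_op ^^ b) u_vec) x) (resolvent_vec (Suc k - b)))"
      by (simp add: bounded_opD[OF bounded_op_T] bounded_opD[OF bounded_op_P] resolvent_diff_def
          P_T_resolvent_vec Suc_diff_le)
    \<comment> \<open>The correction term of the projection supplies the missing summand
      \<open>b = Suc k\<close>, where \<open>resolvent_vec 0\<close> is
      \<open>u_vec\<close>.\<close>
    also have "P_op ((T_op ^^ Suc k) x) =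
        (T_op ^^ Suc k) x - cscale (cinner ((T_op ^^ Suc k) u_vec) x) u_vec"
      by (simp only: P_op_eq symmetric_opD[OF symmetric_op_funpow[OF symmetric_op_T]])
    also have "\<dots> - (\<Sum>b\<le>k. cscale (cinner ((T_op ^^ b) u_vec) x) (resolvent_vec (Suc k - b)))
       = (T_op ^^ Suc k) x - resolvent_diff (Suc k) x"
      by (simp add: resolvent_diff_def resolvent_vec_0)
    finally have "(T_perp ^^ Suc k) (P_op x) = (T_op ^^ Suc k) x - resolvent_diff (Suc k) x" .
    moreover have "P_op ((T_perp ^^ Suc k) (P_op x)) = (T_perp ^^ Suc k) (P_op x)"
      by (simp add: T_perp_eq[of "(T_perp ^^ k) _"] P_op_P_op)
    ultimately show ?case by blast
  qed
  thus ?thesis ..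
qed

lemma power_diff_eq:
  assumes "k > 0"
  shows "power_diff k x = resolvent_diff k x"
proof -
  obtain l where k: "k = Suc l" using assms by (cases k) auto
  \<comment> \<open>The innermost \<open>T_perp\<close> absorbs the extra projection. For k = 0
    there is none: \<open>power_diff 0\<close> vanishes while \<open>resolvent_diff 0\<close> is the
    projection onto \<open>u_vec\<close>.\<close>
  have "(T_perp ^^ k) (P_op x) = (T_perp ^^ k) x"
    unfolding k funpow_Suc_right by (simp add: T_perp_eq P_op_P_op)
  thus ?thesis using T_perp_funpow_P[of k x] by (simp add: power_diff_def algebra_simps)
qed

lemma trace_class_power_diff: "k > 0 \<Longrightarrow> trace_class (power_diff k)"
  by (rule trace_class_symmetric_finite_rank[OF symmetric_op_power_diff finite_atMost[of k]])
     (simp add: power_diff_eq resolvent_diff_def)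

text \<open>Each \<open>j = a + b\<close> is hit by \<open>Suc j\<close> pairs; this multiplicity is
  the source of the derivative in the trace formula.\<close>

lemma sum_triangle_eq:
  fixes f :: "nat \<Rightarrow> 'a :: comm_semiring_1"
  shows "(\<Sum>b\<le>k. \<Sum>a\<le>k-b. f (a + b)) = (\<Sum>j\<le>k. of_nat (Suc j) * f j)"
proof (induction k)
  case (Suc k)
  have "(\<Sum>b\<le>Suc k. \<Sum>a\<le>Suc k-b. f (a + b)) =
      (\<Sum>b\<le>k. (\<Sum>a\<le>k-b. f (a + b)) + f (Suc k)) + f (Suc k)"
    by (simp add: Suc_diff_le)
  thus ?case using Suc by (simp add: sum.distrib algebra_simps)
qed simp

text \<open>With M the moment series, the trace is the k-th coefficient of (z M)' / M = 1 + z M' /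
  M, and for positive k the summand 1 does not contribute.\<close>

lemma tau_eq:
  assumes "k > 0"
  shows "tau k = of_real (fps_nth (fps_deriv (moment_fps abs_gregory_coeffs) * inverse (moment_fps abs_gregory_coeffs)) (k - 1))"
proof -
  let ?M = "moment_fps abs_gregory_coeffs"
  have "tau k = (\<Sum>b\<le>k. cinner ((T_op ^^ b) u_vec) (resolvent_vec (k - b)))"
    unfolding tau_def
    by (rule trace_finite_rank) (simp_all add: power_diff_eq[OF assms] resolvent_diff_def)
  also have "\<dots> = of_real (\<Sum>b\<le>k. \<Sum>a\<le>k-b. fps_nth (inverse ?M) (k - (a + b)) * moment abs_gregory_coeffs (a + b))"
    by (simp add: resolvent_vec_def cinner_sum_right cinner_scaleR_right cinner_T_powers_u add_ac)
  also have "(\<Sum>b\<le>k. \<Sum>a\<le>k-b. fps_nth (inverse ?M) (k - (a + b)) * moment abs_gregory_coeffs (a + b)) =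
      (\<Sum>j\<le>k. real (Suc j) * (fps_nth (inverse ?M) (k - j) * moment abs_gregory_coeffs j))"
    by (rule sum_triangle_eq)
  also have "\<dots> = fps_nth (fps_deriv (fps_X * ?M) * inverse ?M) k"
  proof -
    have "fps_nth (fps_deriv (fps_X * ?M)) j = real (Suc j) * moment abs_gregory_coeffs j" for j
      by (simp only: fps_deriv_nth fps_X_mult_nth) (simp add: moment_fps_def)
    thus ?thesis
      unfolding fps_mult_nth atLeast0AtMost by (simp add: mult_ac del: of_nat_Suc)
  qed
  also have "fps_deriv (fps_X * ?M) * inverse ?M = 1 + fps_X * (fps_deriv ?M * inverse ?M)"
    using moment_fps_mult_inverse by (simp add: algebra_simps)
  also have "fps_nth \<dots> k = fps_nth (fps_deriv ?M * inverse ?M) (k - 1)"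
    using assms by simp
  finally show ?thesis .
qed

end

section \<open>Zeros of a sum of poles\<close>

definition pole_term :: "(nat \<Rightarrow> real) \<Rightarrow> nat \<Rightarrow> real \<Rightarrow> real" where
  "pole_term w j x = w j * (real (Suc j) / (real (Suc j) - x))"

lemma of_real_notin_posnats:
  assumes "real n < x" "x < real n + 1"
  shows "complex_of_real x \<notin> posnats"
proof
  assume "complex_of_real x \<in> posnats"
  then obtain j where "complex_of_real x = complex_of_real (real (Suc j))" by auto
  hence "x = real (Suc j)" by (simp only: of_real_eq_iff)
  thus False using assms by auto
qed

text \<open>Strict positivity is what gives a genuine pole at every positive integer and strict
  growth in every gap.\<close>

locale positive_weights =
  fixes w :: "nat \<Rightarrow> real"
  assumes w_summable: "summable w" and pos: "w j > 0"
begin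

sublocale summable_weights w
  by standard (use w_summable pos in \<open>auto intro: less_imp_le\<close>)

definition real_pole_sum :: "real \<Rightarrow> real" where
  "real_pole_sum x = Re (pole_sum w (of_real x))"

context
  fixes n :: nat
begin

lemma real_pole_sum_sums:
  assumes "real n < x" "x < real n + 1"
  shows "(\<lambda>j. pole_term w j x) sums real_pole_sum x"
proof -
  have "(\<lambda>j. Re (of_real (w j) * (of_nat (Suc j) / (of_nat (Suc j) - of_real x)))) sums real_pole_sum x"
    unfolding real_pole_sum_def by (rule sums_Re[OF pole_sum_sums[OF of_real_notin_posnats[OF assms]]])
  moreover have "Re (of_real (w j) * (of_nat (Suc j) / (of_nat (Suc j) - of_real x))) = pole_term w j x" for j
  proof -
    have "of_real (w j) * (of_nat (Suc j) / (of_nat (Suc j) - of_real x)) = complex_of_real (pole_term w j x)"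
      by (simp add: pole_term_def)
    thus ?thesis by (simp only: Re_complex_of_real)
  qed
  ultimately show ?thesis by simp
qed

lemma pole_sum_of_real:
  assumes "real n < x" "x < real n + 1"
  shows "pole_sum w (of_real x) = of_real (real_pole_sum x)"
proof -
  have "(\<lambda>j. complex_of_real (pole_term w j x)) sums of_real (real_pole_sum x)"
    by (rule sums_of_real[OF real_pole_sum_sums[OF assms]])
  moreover have "(\<lambda>j. complex_of_real (pole_term w j x)) sums pole_sum w (of_real x)"
    using pole_sum_sums[OF of_real_notin_posnats[OF assms]] by (simp add: pole_term_def)
  ultimately show ?thesis by (metis sums_unique2)
qed

lemma pole_term_strict_mono:
  assumes "real n < x" "x < y" "y < real n + 1"
  shows "pole_term w j x < pole_term w j y"
proof -
  have "real (Suc j) / (real (Suc j) - x) < real (Suc j) / (real (Suc j) - y)"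
  proof (cases "j < n")
    case True
    hence *: "real (Suc j) \<le> real n" by (simp only: of_nat_le_iff Suc_le_eq)
    have "real (Suc j) / (y - real (Suc j)) < real (Suc j) / (x - real (Suc j))"
      using assms * by (intro divide_strict_left_mono mult_pos_pos) auto
    thus ?thesis by (metis minus_diff_eq minus_divide_right neg_less_iff_less)
  next
    case False
    hence "real (Suc j) \<ge> real n + 1" by simp
    thus ?thesis using assms by (intro divide_strict_left_mono mult_pos_pos) auto
  qed
  thus ?thesis unfolding pole_term_def using pos[of j] by (rule mult_strict_left_mono)
qed

text \<open>All terms increase within a gap, so discarding all but one gives a lower bound. One term
  can thus control the whole sum close to its pole.\<close>

lemma real_pole_sum_diff_ge:
  assumes "real n < x" "x < y" "y < real n + 1"
  shows "pole_term w j y - pole_term w j x \<le> real_pole_sum y - real_pole_sum x"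
proof -
  have s: "(\<lambda>j. pole_term w j y - pole_term w j x) sums (real_pole_sum y - real_pole_sum x)"
    using assms by (intro sums_diff real_pole_sum_sums) auto
  have "(\<Sum>j\<in>{j}. pole_term w j y - pole_term w j x) \<le> (\<Sum>j. pole_term w j y - pole_term w j x)"
    by (rule sum_le_suminf)
       (use s pole_term_strict_mono[OF assms] in \<open>auto simp: sums_iff less_imp_le\<close>)
  thus ?thesis using s by (simp add: sums_iff)
qed

lemma real_pole_sum_strict_mono:
  assumes "real n < x" "x < y" "y < real n + 1"
  shows "real_pole_sum x < real_pole_sum y"
  using real_pole_sum_diff_ge[OF assms, of 0] pole_term_strict_mono[OF assms, of 0] by linarith

lemma continuous_on_real_pole_sum:
  assumes "real n < a" "b < real n + 1"
  shows "continuous_on {a..b} real_pole_sum"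
proof -
  have "complex_of_real x \<notin> posnats" if "x \<in> {a..b}" for x
    using of_real_notin_posnats[of n x] assms that by simp
  hence "of_real ` {a..b} \<subseteq> - posnats" by (metis ComplI image_subsetI)
  hence "continuous_on (of_real ` {a..b}) (pole_sum w)"
    by (rule holomorphic_on_imp_continuous_on[OF holomorphic_on_subset[OF pole_sum_holomorphic]])
  hence "continuous_on {a..b} (\<lambda>x. pole_sum w (of_real x))"
    by (rule continuous_on_compose2) (auto intro: continuous_intros)
  thus ?thesis unfolding real_pole_sum_def by (intro continuous_intros)
qed

lemma real_pole_sum_unique_zero:
  assumes n: "n \<ge> 1"
  shows "\<exists>!x. real n < x \<and> x < real n + 1 \<and> real_pole_sum x = 0"
proof -
  define c where "c = real n + 1/2"
  obtain i where i: "n = Suc i" using n by (cases n) auto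
  have "\<exists>x. real n < x \<and> x < c \<and> real_pole_sum x < 0"
  proof -
    \<comment> \<open>\<open>C\<close> exceeds the contribution of the remaining terms at the
      midpoint \<open>c\<close>; \<open>d\<close> is the distance at which the term with pole n
      reaches size \<open>C\<close>, capped to stay left of \<open>c\<close>. The right end of the
      gap is treated alike.\<close>
    define C where "C = \<bar>real_pole_sum c - pole_term w i c\<bar> + 1"
    define d where "d = min (1/4) (w i * real n / C)"
    have C: "C > 0" by (simp add: C_def)
    have d: "d > 0" "d \<le> 1/4"
      using C pos[of i] n by (simp add: d_def) (simp only: d_def min.cobounded1)
    have "d \<le> w i * real n / C" by (simp add: d_def)
    hence "C \<le> w i * real n / d" using C d by (simp add: field_simps)
    moreover have "pole_term w i (real n + d) = - (w i * real n / d)"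
      by (simp add: pole_term_def i)
    moreover have "real_pole_sum (real n + d) \<le> real_pole_sum c - pole_term w i c + pole_term w i (real n + d)"
      using real_pole_sum_diff_ge[of "real n + d" c i] d by (simp add: c_def)
    ultimately have "real_pole_sum (real n + d) < 0" unfolding C_def by linarith
    thus ?thesis using d by (intro exI[of _ "real n + d"]) (auto simp: c_def)
  qed
  then obtain a where a: "real n < a" "a < c" "real_pole_sum a < 0" by blast
  have "\<exists>x. c < x \<and> x < real n + 1 \<and> real_pole_sum x > 0"
  proof -
    define C where "C = \<bar>real_pole_sum c - pole_term w n c\<bar> + 1"
    define d where "d = min (1/4) (w n * real (Suc n) / C)"
    have C: "C > 0" by (simp add: C_def)
    have d: "d > 0" "d \<le> 1/4"
      using C pos[of n] n by (simp add: d_def) (simp only: d_def min.cobounded1)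
    have "d \<le> w n * real (Suc n) / C" by (simp add: d_def)
    hence "C \<le> w n * real (Suc n) / d" using C d by (simp add: field_simps del: of_nat_Suc)
    moreover have "pole_term w n (real n + 1 - d) = w n * real (Suc n) / d"
      by (simp add: pole_term_def)
    moreover have "real_pole_sum (real n + 1 - d) \<ge> real_pole_sum c - pole_term w n c + pole_term w n (real n + 1 - d)"
      using real_pole_sum_diff_ge[of c "real n + 1 - d" n] d by (simp add: c_def)
    ultimately have "real_pole_sum (real n + 1 - d) > 0" unfolding C_def by linarith
    thus ?thesis using d by (intro exI[of _ "real n + 1 - d"]) (auto simp: c_def)
  qed
  then obtain b where b: "c < b" "b < real n + 1" "real_pole_sum b > 0" by blast
  obtain x where x: "a \<le> x" "x \<le> b" "real_pole_sum x = 0"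
    using IVT'[of real_pole_sum a 0 b] a b continuous_on_real_pole_sum[of a b] by force
  show ?thesis
  proof (rule ex1I[of _ x])
    fix y assume "real n < y \<and> y < real n + 1 \<and> real_pole_sum y = 0"
    thus "y = x"
      using x a b real_pole_sum_strict_mono[of x y] real_pole_sum_strict_mono[of y x]
      by (cases x y rule: linorder_cases) auto
  qed (use x a b in auto)
qed

end

text \<open>Numerator of the sum over the first N poles, over the common denominator formed by all
  factors 1 - x / n with n at most N.\<close>

definition truncated_poly :: "nat \<Rightarrow> real poly" where
  "truncated_poly N = (\<Sum>j<N. smult (w j) (\<Prod>i\<in>{..<N}-{j}. [:1, - 1 / real (Suc i):]))"

lemma poly_truncated_poly:
  "poly (truncated_poly N) x = (\<Sum>j<N. w j * (\<Prod>i\<in>{..<N}-{j}. 1 - x / real (Suc i)))"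
  by (simp add: truncated_poly_def poly_sum poly_prod del: of_nat_Suc)

text \<open>At the pole \<open>Suc j\<close> every summand but the j-th contains a vanishing factor,
  and the survivor has exactly j negative ones. The alternating signs place a root in each
  gap.\<close>

lemma poly_truncated_poly_at_nat:
  assumes "j < N"
  shows "(-1) ^ j * poly (truncated_poly N) (real (Suc j)) > 0"
proof -
  let ?g = "\<lambda>i. 1 - real (Suc j) / real (Suc i)"
  have "poly (truncated_poly N) (real (Suc j)) =
      (\<Sum>l\<in>{j}. w l * (\<Prod>i\<in>{..<N}-{l}. ?g i))"
    unfolding poly_truncated_poly
  proof (rule sum.mono_neutral_right)
    show "\<forall>l\<in>{..<N} - {j}. w l * (\<Prod>i\<in>{..<N}-{l}. ?g i) = 0"
    proof
      fix l assume "l \<in> {..<N} - {j}"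
      hence "\<exists>i\<in>{..<N} - {l}. ?g i = 0" using assms by (intro bexI[of _ j]) auto
      hence "(\<Prod>i\<in>{..<N}-{l}. ?g i) = 0" by (subst prod_zero_iff) auto
      thus "w l * (\<Prod>i\<in>{..<N}-{l}. ?g i) = 0" by simp
    qed
  qed (use assms in auto)
  also have "\<dots> = w j * (\<Prod>i\<in>{..<j} \<union> {j<..<N}. ?g i)"
    using assms by (auto intro!: prod.cong)
  also have "\<dots> = w j * ((\<Prod>i<j. ?g i) * (\<Prod>i\<in>{j<..<N}. ?g i))"
    by (subst prod.union_disjoint) auto
  also have "(\<Prod>i<j. ?g i) = (-1) ^ j * (\<Prod>i<j. real (Suc j) / real (Suc i) - 1)"
    using prod_uminus[of "\<lambda>i. real (Suc j) / real (Suc i) - 1" "{..<j}"] by simp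
  finally have "(-1) ^ j * poly (truncated_poly N) (real (Suc j)) =
      ((-1) ^ j * (-1) ^ j) * (w j * ((\<Prod>i<j. real (Suc j) / real (Suc i) - 1) * (\<Prod>i\<in>{j<..<N}. ?g i)))"
    by (simp only: mult_ac)
  also have "((-1) ^ j * (-1) ^ j :: real) = 1"
    by (simp flip: power_mult_distrib)
  also have "1 * (w j * ((\<Prod>i<j. real (Suc j) / real (Suc i) - 1) * (\<Prod>i\<in>{j<..<N}. ?g i))) > 0"
    using pos[of j] by (auto intro!: mult_pos_pos prod_pos simp: field_simps)
  finally show ?thesis .
qed

lemma truncated_poly_root:
  assumes "Suc j < N"
  shows "\<exists>x. real (Suc j) < x \<and> x < real (Suc j) + 1 \<and> poly (truncated_poly N) x = 0"
proof -
  let ?p = "poly (truncated_poly N)"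
  have "0 < ((-1) ^ j * ?p (real (Suc j))) * ((-1) ^ Suc j * ?p (real (Suc (Suc j))))"
    using assms by (intro mult_pos_pos[OF poly_truncated_poly_at_nat poly_truncated_poly_at_nat]) auto
  also have "\<dots> = ((-1) ^ j * (-1) ^ j) * - (?p (real (Suc j)) * ?p (real (Suc (Suc j))))"
    by (simp add: mult_ac)
  also have "((-1) ^ j * (-1) ^ j :: real) = 1"
    by (simp flip: power_mult_distrib)
  finally have "?p (real (Suc j)) * ?p (real (Suc (Suc j))) < 0" by simp
  from poly_IVT[OF _ this] show ?thesis by force
qed

text \<open>N poles leave N - 1 gaps, so the choice is meaningful only for
  \<open>Suc j < N\<close>.\<close>

definition truncated_zero :: "nat \<Rightarrow> nat \<Rightarrow> real" where
  "truncated_zero N j =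
     (SOME x. real (Suc j) < x \<and> x < real (Suc j) + 1 \<and> poly (truncated_poly N) x = 0)"

lemma truncated_zero:
  assumes "Suc j < N"
  shows "real (Suc j) < truncated_zero N j" "truncated_zero N j < real (Suc j) + 1"
    "poly (truncated_poly N) (truncated_zero N j) = 0"
  using someI_ex[OF truncated_poly_root[OF assms]] unfolding truncated_zero_def by auto

lemma sum_pole_term_truncated_zero:
  assumes "Suc j < N"
  shows "(\<Sum>l<N. pole_term w l (truncated_zero N j)) = 0"
proof -
  define x where "x = truncated_zero N j"
  have x: "real (Suc j) < x" "x < real (Suc j) + 1" "poly (truncated_poly N) x = 0"
    using truncated_zero[OF assms] by (auto simp: x_def)
  have ne: "real (Suc i) - x \<noteq> 0" for i
  proof
    assume "real (Suc i) - x = 0"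
    hence "real (Suc j) < real (Suc i)" "real (Suc i) < real (Suc (Suc j))" using x by auto
    thus False unfolding of_nat_less_iff by simp
  qed
  define p where "p = (\<Prod>i<N. 1 - x / real (Suc i))"
  have p: "p \<noteq> 0" using ne by (auto simp: p_def field_simps)
  have "p * (\<Sum>l<N. pole_term w l x) = poly (truncated_poly N) x"
    unfolding poly_truncated_poly sum_distrib_left
  proof (rule sum.cong)
    fix l assume l: "l \<in> {..<N}"
    have "p = (1 - x / real (Suc l)) * (\<Prod>i\<in>{..<N}-{l}. 1 - x / real (Suc i))"
      unfolding p_def using l by (intro prod.remove) auto
    moreover have "(1 - x / real (Suc l)) * pole_term w l x = w l"
    proof -
      have "1 - x / real (Suc l) = (real (Suc l) - x) / real (Suc l)"
        by (simp add: diff_divide_distrib)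
      thus ?thesis using ne[of l] by (simp add: pole_term_def del: of_nat_Suc)
    qed
    ultimately show "p * pole_term w l x = w l * (\<Prod>i\<in>{..<N}-{l}. 1 - x / real (Suc i))"
      by (metis mult.assoc mult.commute)
  qed simp
  thus ?thesis using x p by (simp add: x_def)
qed

text \<open>At a point a of the gap other than \<rho> the full sum has a strict sign, which the
  truncated sums eventually share. As these increase, their zero must lie on the same side of a as
  \<rho>.\<close>

lemma truncated_zero_tendsto:
  assumes \<rho>: "real (Suc j) < \<rho>" "\<rho> < real (Suc j) + 1" "real_pole_sum \<rho> = 0"
  shows "(\<lambda>N. truncated_zero N j) \<longlonglongrightarrow> \<rho>"
proof (rule order_tendstoI)
  have lim: "(\<lambda>N. \<Sum>l<N. pole_term w l x) \<longlonglongrightarrow> real_pole_sum x"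
    if "real (Suc j) < x" "x < real (Suc j) + 1" for x
    using real_pole_sum_sums[OF that] by (simp add: sums_def)
  have N: "eventually (\<lambda>N. Suc j < N) sequentially" by (rule eventually_gt_at_top)
  have mono: "(\<Sum>l<N. pole_term w l x) \<le> (\<Sum>l<N. pole_term w l y)"
    if "real (Suc j) < x" "x \<le> y" "y < real (Suc j) + 1" for x y N
  proof (rule sum_mono)
    show "pole_term w l x \<le> pole_term w l y" for l
      using that pole_term_strict_mono[of "Suc j" x y l] by (cases "x = y") auto
  qed
  fix a
  show "eventually (\<lambda>N. a < truncated_zero N j) sequentially" if "a < \<rho>"
  proof (cases "a \<le> real (Suc j)")
    case True
    show ?thesis using N by eventually_elim (use True truncated_zero(1) in force)
  next
    case False
    hence "real_pole_sum a < 0"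
      using real_pole_sum_strict_mono[of "Suc j" a \<rho>] that \<rho> by auto
    hence "eventually (\<lambda>N. (\<Sum>l<N. pole_term w l a) < 0) sequentially"
      using lim[of a] False that \<rho> by (intro order_tendstoD) auto
    thus ?thesis using N
    proof eventually_elim
      case (elim N)
      show ?case
      proof (rule ccontr)
        assume "\<not> ?thesis"
        hence "(\<Sum>l<N. pole_term w l (truncated_zero N j)) \<le> (\<Sum>l<N. pole_term w l a)"
          using truncated_zero[OF elim(2)] that \<rho> by (intro mono) auto
        thus False using elim sum_pole_term_truncated_zero by simp
      qed
    qed
  qed
  show "eventually (\<lambda>N. a > truncated_zero N j) sequentially" if "a > \<rho>"
  proof (cases "a \<ge> real (Suc j) + 1")
    case True
    show ?thesis using N by eventually_elim (use True truncated_zero(2) in force)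
  next
    case False
    hence "real_pole_sum a > 0"
      using real_pole_sum_strict_mono[of "Suc j" \<rho> a] that \<rho> by auto
    hence "eventually (\<lambda>N. (\<Sum>l<N. pole_term w l a) > 0) sequentially"
      using lim[of a] False that \<rho> by (intro order_tendstoD) auto
    thus ?thesis using N
    proof eventually_elim
      case (elim N)
      show ?case
      proof (rule ccontr)
        assume "\<not> ?thesis"
        hence "(\<Sum>l<N. pole_term w l (truncated_zero N j)) \<ge> (\<Sum>l<N. pole_term w l a)"
          using truncated_zero[OF elim(2)] that \<rho> by (intro mono) auto
        thus False using elim sum_pole_term_truncated_zero by simp
      qed
    qed
  qed
qed

text \<open>The L zeros lie in disjoint gaps, hence are distinct, and the degree is at most L, which
  leaves only a constant cofactor.\<close>

lemma truncated_poly_factorization: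
  obtains c where "c \<noteq> 0"
    "truncated_poly (Suc L) = smult c (\<Prod>j<L. [:- truncated_zero (Suc L) j, 1:])"
proof -
  let ?z = "truncated_zero (Suc L)" and ?P = "truncated_poly (Suc L)"
  have z: "real (Suc j) < ?z j" "?z j < real (Suc j) + 1" "poly ?P (?z j) = 0" if "j < L" for j
    using truncated_zero[of j "Suc L"] that by auto
  have inj: "inj_on ?z {..<L}"
  proof (rule inj_onI)
    fix i j assume ij: "i \<in> {..<L}" "j \<in> {..<L}" "?z i = ?z j"
    hence "real (Suc i) < real (Suc (Suc j))" "real (Suc j) < real (Suc (Suc i))"
      using z[of i] z[of j] by auto
    thus "i = j" unfolding of_nat_less_iff by simp
  qed
  have "(\<Prod>a\<in>?z ` {..<L}. [:- a, 1:]) dvd ?P"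
    by (rule prod_roots_dvd) (use z in auto)
  then obtain q where q: "?P = (\<Prod>j<L. [:- ?z j, 1:]) * q"
    by (auto simp: prod.reindex[OF inj])
  have P0: "?P \<noteq> 0" using poly_truncated_poly_at_nat[of 0 "Suc L"] by auto
  have "degree ?P \<le> L"
    unfolding truncated_poly_def
  proof (rule degree_sum_le)
    fix j assume "j \<in> {..<Suc L}"
    have "degree (\<Prod>i\<in>{..<Suc L}-{j}. [:1, - 1 / real (Suc i):]) \<le> (\<Sum>i\<in>{..<Suc L}-{j}. 1)"
      by (rule order_trans[OF degree_prod_sum_le]) (auto intro!: sum_mono)
    also have "\<dots> = L" using \<open>j \<in> {..<Suc L}\<close> by simp
    finally show "degree (smult (w j) (\<Prod>i\<in>{..<Suc L}-{j}. [:1, - 1 / real (Suc i):])) \<le> L"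
      using pos[of j] by simp
  qed simp
  moreover have "degree ?P = L + degree q"
    using P0 by (simp add: q degree_mult_eq degree_prod_eq_sum_degree)
  ultimately have "degree q = 0" by simp
  then obtain c where "q = [:c:]" by (rule degree_eq_zeroE)
  thus ?thesis using q P0 by (intro that[of c]) auto
qed

end

section \<open>Logarithmic derivatives of power series\<close>

definition fps_dlog :: "real fps \<Rightarrow> real fps" where
  "fps_dlog f = fps_deriv f * inverse f"

lemma fps_dlog_mult:
  assumes "fps_nth f 0 \<noteq> 0" "fps_nth g 0 \<noteq> 0"
  shows "fps_dlog (f * g) = fps_dlog f + fps_dlog g"
  using inverse_mult_eq_1'[OF assms(1)] inverse_mult_eq_1'[OF assms(2)]
  unfolding fps_dlog_def fps_inverse_mult fps_deriv_mult by algebra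

lemma fps_prod_nth_0: "fps_nth (\<Prod>i\<in>I. f i) 0 = (\<Prod>i\<in>I. fps_nth (f i) 0)"
  by (induction I rule: infinite_finite_induct) simp_all

lemma fps_const_prod: "fps_const (\<Prod>i\<in>I. f i) = (\<Prod>i\<in>I. fps_const (f i))"
  by (induction I rule: infinite_finite_induct) (simp_all flip: fps_const_mult)

lemma fps_dlog_prod:
  assumes "finite I" "\<And>i. i \<in> I \<Longrightarrow> fps_nth (f i) 0 \<noteq> 0"
  shows "fps_dlog (\<Prod>i\<in>I. f i) = (\<Sum>i\<in>I. fps_dlog (f i))"
  using assms
  by (induction I rule: finite_induct) (auto simp: fps_dlog_mult fps_prod_nth_0, simp add: fps_dlog_def)

lemma fps_dlog_const_mult:
  assumes "c \<noteq> 0" "fps_nth f 0 \<noteq> 0"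
  shows "fps_dlog (fps_const c * f) = fps_dlog f"
  using fps_dlog_mult[of "fps_const c" f] assms by (simp add: fps_dlog_def)

lemma fps_geometric:
  fixes a :: "'a :: comm_ring_1"
  shows "(1 - fps_const a * fps_X) * Abs_fps (\<lambda>n. a ^ n) = 1"
proof (rule fps_ext)
  fix n
  show "fps_nth ((1 - fps_const a * fps_X) * Abs_fps (\<lambda>n. a ^ n)) n = fps_nth 1 n"
    by (cases n) (simp_all add: left_diff_distrib mult.assoc)
qed

lemma fps_dlog_linear: "fps_nth (fps_dlog (1 - fps_const a * fps_X)) k = - (a ^ Suc k)"
proof -
  have "inverse (1 - fps_const a * fps_X) = Abs_fps (\<lambda>n. a ^ n)"
    by (rule fps_inverse_unique[OF fps_geometric])
  thus ?thesis by (simp add: fps_dlog_def)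
qed

text \<open>By the recursion for the inverse, each coefficient depends continuously on finitely many
  coefficients of the series.\<close>

lemma fps_inverse_nth_tendsto:
  fixes F :: "nat \<Rightarrow> real fps"
  assumes lim: "\<And>k. (\<lambda>N. fps_nth (F N) k) \<longlonglongrightarrow> fps_nth G k" and "fps_nth G 0 \<noteq> 0"
  shows "(\<lambda>N. fps_nth (inverse (F N)) k) \<longlonglongrightarrow> fps_nth (inverse G) k"
proof (induction k rule: less_induct)
  case (less k)
  show ?case
  proof (cases "k = 0")
    case True
    thus ?thesis using assms(2) lim[of 0] by (auto intro: tendsto_intros)
  next
    case False
    have rec: "fps_nth (inverse f) k = - inverse (fps_nth f 0) * (\<Sum>i=1..k. fps_nth f i * fps_nth (inverse f) (k - i))" for f :: "real fps"
      using False by (cases k) (simp_all add: fps_inverse_def)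
    show ?thesis
      unfolding rec by (intro tendsto_intros lim assms(2) less) auto
  qed
qed

lemma fps_dlog_nth_tendsto:
  assumes "\<And>k. (\<lambda>N. fps_nth (F N) k) \<longlonglongrightarrow> fps_nth G k" and "fps_nth G 0 \<noteq> 0"
  shows "(\<lambda>N. fps_nth (fps_dlog (F N)) k) \<longlonglongrightarrow> fps_nth (fps_dlog G) k"
  unfolding fps_dlog_def fps_mult_nth fps_deriv_nth
  by (intro tendsto_intros assms(1) fps_inverse_nth_tendsto[OF assms])

context positive_weights
begin

definition truncated_fps :: "nat \<Rightarrow> real fps" where
  "truncated_fps N = Abs_fps (\<lambda>k. \<Sum>j<N. w j / real (Suc j) ^ k)"

lemma truncated_fps_mult:
  "truncated_fps N * (\<Prod>i<N. 1 - fps_const (1 / real (Suc i)) * fps_X) = fps_of_poly (truncated_poly N)"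
proof -
  let ?l = "\<lambda>i. 1 - fps_const (1 / real (Suc i)) * fps_X"
  let ?g = "\<lambda>j. Abs_fps (\<lambda>k. (1 / real (Suc j)) ^ k)"
  have inv: "?g j * ?l j = 1" for j
    using fps_geometric[of "1 / real (Suc j)"] by (simp only: mult.commute)
  have "truncated_fps N = (\<Sum>j<N. fps_const (w j) * ?g j)"
    by (simp add: fps_eq_iff truncated_fps_def fps_sum_nth power_one_over)
  hence "truncated_fps N * (\<Prod>i<N. ?l i) = (\<Sum>j<N. fps_const (w j) * ?g j * (\<Prod>i<N. ?l i))"
    by (simp add: sum_distrib_right)
  also have "\<dots> = (\<Sum>j<N. fps_const (w j) * (\<Prod>i\<in>{..<N}-{j}. ?l i))"
  proof (rule sum.cong)
    fix j assume "j \<in> {..<N}"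
    hence "(\<Prod>i<N. ?l i) = ?l j * (\<Prod>i\<in>{..<N}-{j}. ?l i)" by (intro prod.remove) auto
    hence "fps_const (w j) * ?g j * (\<Prod>i<N. ?l i) = fps_const (w j) * (?g j * ?l j) * (\<Prod>i\<in>{..<N}-{j}. ?l i)"
      by (simp only: mult_ac)
    thus "fps_const (w j) * ?g j * (\<Prod>i<N. ?l i) = fps_const (w j) * (\<Prod>i\<in>{..<N}-{j}. ?l i)"
      by (simp only: inv mult_1_right)
  qed simp
  also have "\<dots> = fps_of_poly (truncated_poly N)"
  proof -
    have "fps_of_poly [:1, - 1 / real (Suc i):] = ?l i" for i
      by (simp add: fps_of_poly_pCons fps_const_neg[symmetric] del: fps_const_neg of_nat_Suc)
    thus ?thesis
      unfolding truncated_poly_def fps_of_poly_sum fps_of_poly_smult fps_of_poly_prod by (simp only:)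
  qed
  finally show ?thesis .
qed

text \<open>Up to a constant the truncated series is a quotient of products of factors 1 - a X. The
  logarithmic derivative is additive, forgets the constant, and has k-th coefficient -a^(k+1) on
  each factor.\<close>

lemma fps_dlog_truncated_fps:
  "fps_nth (fps_dlog (truncated_fps (Suc L))) k =
     (\<Sum>i<Suc L. (1 / real (Suc i)) ^ Suc k) - (\<Sum>j<L. (1 / truncated_zero (Suc L) j) ^ Suc k)"
proof -
  let ?z = "truncated_zero (Suc L)"
  let ?l = "\<lambda>a. 1 - fps_const a * fps_X :: real fps"
  have z: "?z j > 0" if "j < L" for j
    using truncated_zero(1)[of j "Suc L"] that by (metis Suc_less_eq of_nat_0_le_iff order_le_less_trans)
  have "fps_nth (truncated_fps (Suc L)) 0 = (\<Sum>j<Suc L. w j)" by (simp add: truncated_fps_def)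
  moreover have "\<dots> > 0" by (rule sum_pos) (auto simp: pos)
  ultimately have nz: "fps_nth (truncated_fps (Suc L)) 0 \<noteq> 0" by simp
  obtain c where c: "c \<noteq> 0" "truncated_poly (Suc L) = smult c (\<Prod>j<L. [:- ?z j, 1:])"
    using truncated_poly_factorization .
  \<comment> \<open>Collects the constants from X - \<zeta> = -\<zeta> (1 - X / \<zeta>).\<close>
  define d where "d = c * (\<Prod>j<L. - ?z j)"
  have d: "d \<noteq> 0" using c(1) z by (force simp: d_def)
  have lin: "fps_of_poly [:- ?z j, 1:] = fps_const (- ?z j) * ?l (1 / ?z j)" if "j < L" for j
  proof -
    have "fps_of_poly [:- ?z j, 1:] = fps_const (- ?z j) + fps_X"
      by (simp add: fps_of_poly_pCons)
    also have "\<dots> = fps_const (- ?z j) * ?l (1 / ?z j)"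
      using z[OF that] by (simp add: fps_eq_iff fps_X_def)
    finally show ?thesis .
  qed
  have "fps_of_poly (truncated_poly (Suc L)) = fps_const c * (\<Prod>j<L. fps_of_poly [:- ?z j, 1:])"
    unfolding c(2) fps_of_poly_smult fps_of_poly_prod ..
  also have "(\<Prod>j<L. fps_of_poly [:- ?z j, 1:]) = (\<Prod>j<L. fps_const (- ?z j) * ?l (1 / ?z j))"
    by (rule prod.cong) (use lin in auto)
  also have "\<dots> = (\<Prod>j<L. fps_const (- ?z j)) * (\<Prod>j<L. ?l (1 / ?z j))"
    by (rule prod.distrib)
  also have "(\<Prod>j<L. fps_const (- ?z j)) = fps_const (\<Prod>j<L. - ?z j)"
    by (rule fps_const_prod[symmetric])
  finally have eq: "truncated_fps (Suc L) * (\<Prod>i<Suc L. ?l (1 / real (Suc i))) =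
      fps_const d * (\<Prod>j<L. ?l (1 / ?z j))"
    by (simp only: truncated_fps_mult d_def fps_const_mult[symmetric] mult.assoc)
  have "fps_dlog (truncated_fps (Suc L) * (\<Prod>i<Suc L. ?l (1 / real (Suc i)))) =
      fps_dlog (truncated_fps (Suc L)) + (\<Sum>i<Suc L. fps_dlog (?l (1 / real (Suc i))))"
    using nz by (subst fps_dlog_mult; (subst fps_dlog_prod)?) (auto simp: fps_prod_nth_0)
  moreover have "fps_dlog (fps_const d * (\<Prod>j<L. ?l (1 / ?z j))) = (\<Sum>j<L. fps_dlog (?l (1 / ?z j)))"
    using d by (subst fps_dlog_const_mult; (subst fps_dlog_prod)?) (auto simp: fps_prod_nth_0)
  ultimately have "fps_dlog (truncated_fps (Suc L)) + (\<Sum>i<Suc L. fps_dlog (?l (1 / real (Suc i)))) =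
      (\<Sum>j<L. fps_dlog (?l (1 / ?z j)))"
    using eq by simp
  hence "fps_nth (fps_dlog (truncated_fps (Suc L)) + (\<Sum>i<Suc L. fps_dlog (?l (1 / real (Suc i))))) k =
      fps_nth (\<Sum>j<L. fps_dlog (?l (1 / ?z j))) k" by (rule arg_cong)
  thus ?thesis
    by (simp only: fps_add_nth fps_sum_nth fps_dlog_linear sum_negf)
qed

lemma zeros_power_sums:
  assumes \<rho>: "\<And>n. n \<ge> 1 \<Longrightarrow> real n < \<rho> n \<and> \<rho> n < real n + 1 \<and> real_pole_sum (\<rho> n) = 0"
    and k: "k > 0"
  shows "(\<lambda>n. 1 / real (Suc n) ^ k - 1 / \<rho> (Suc n) ^ k) sums fps_nth (fps_dlog (moment_fps w)) (k - 1)"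
proof -
  let ?z = "\<lambda>L. truncated_zero (Suc L)"
  \<comment> \<open>The j-th pole is paired with the zero in the gap to its right; Tannery's theorem
    is applied to these pairs.\<close>
  define a where "a j L = (if j < L then (1 / real (Suc j)) ^ k - (1 / ?z L j) ^ k else 0)" for j L
  define b where "b j = (1 / real (Suc j)) ^ k - (1 / \<rho> (Suc j)) ^ k" for j
  \<comment> \<open>The zero lies between \<open>Suc j\<close> and \<open>Suc (Suc j)\<close>, so
    replacing it by the next pole gives a telescoping bound independent of \<open>L\<close>.\<close>
  define M where "M j = (1 / real (Suc j)) ^ k - (1 / real (Suc (Suc j))) ^ k" for j
  have "(\<lambda>j. (1 / real (Suc j)) ^ k) \<longlonglongrightarrow> 0 ^ k"
    by (intro tendsto_power LIMSEQ_Suc[OF lim_1_over_n])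
  hence pow0: "(\<lambda>j. (1 / real (Suc j)) ^ k) \<longlonglongrightarrow> 0" using k by (simp only: power_0_left) simp
  have M: "summable M"
    unfolding M_def using telescope_summable'[OF pow0] by simp
  have lim: "(\<lambda>L. a j L) \<longlonglongrightarrow> b j" for j
  proof -
    have r: "real (Suc j) < \<rho> (Suc j)" "\<rho> (Suc j) < real (Suc j) + 1" "real_pole_sum (\<rho> (Suc j)) = 0"
      using \<rho>[of "Suc j"] by auto
    hence "\<rho> (Suc j) \<noteq> 0" by linarith
    hence "(\<lambda>L. (1 / real (Suc j)) ^ k - (1 / ?z L j) ^ k) \<longlonglongrightarrow> b j"
      unfolding b_def by (intro tendsto_intros LIMSEQ_Suc[OF truncated_zero_tendsto[OF r]])
    thus ?thesis
      by (rule Lim_transform_eventually)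
         (use eventually_gt_at_top[of j] in eventually_elim, simp add: a_def)
  qed
  have bound: "norm (a j L) \<le> M j" for j L
  proof (cases "j < L")
    case True
    hence z: "real (Suc j) < ?z L j" "?z L j < real (Suc (Suc j))"
      using truncated_zero[of j "Suc L"] by auto
    have "0 < real (Suc j)" by simp
    hence "0 < ?z L j" using z by linarith
    hence "(1 / ?z L j) ^ k \<le> (1 / real (Suc j)) ^ k" "(1 / real (Suc (Suc j))) ^ k \<le> (1 / ?z L j) ^ k"
      using z by (intro power_mono divide_left_mono; simp)+
    thus ?thesis using True by (simp add: a_def M_def)
  next
    case False
    have "(1 / real (Suc (Suc j))) ^ k \<le> (1 / real (Suc j)) ^ k"
      by (intro power_mono divide_left_mono) auto
    thus ?thesis using False by (simp add: a_def M_def)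
  qed
  from tannerys_theorem[OF lim always_eventually M sequentially_bot]
  have b: "summable (\<lambda>j. norm (b j))" "(\<lambda>L. suminf (\<lambda>j. a j L)) \<longlonglongrightarrow> suminf b"
    using bound by (auto simp: case_prod_unfold)
  \<comment> \<open>There are L + 1 poles but only L zeros; the unpaired last pole leaves a term
    that tends to 0.\<close>
  have sum_a: "suminf (\<lambda>j. a j L) = fps_nth (fps_dlog (truncated_fps (Suc L))) (k - 1) - (1 / real (Suc L)) ^ k" for L
  proof -
    have "suminf (\<lambda>j. a j L) = (\<Sum>j<L. a j L)"
      by (rule suminf_finite) (auto simp: a_def)
    also have "\<dots> = (\<Sum>j<L. (1 / real (Suc j)) ^ k) - (\<Sum>j<L. (1 / ?z L j) ^ k)"
      by (simp add: a_def sum_subtractf)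
    finally show ?thesis using k by (simp add: fps_dlog_truncated_fps)
  qed
  have "(\<lambda>L. fps_nth (fps_dlog (truncated_fps (Suc L))) (k - 1)) \<longlonglongrightarrow> fps_nth (fps_dlog (moment_fps w)) (k - 1)"
  proof (rule fps_dlog_nth_tendsto)
    show "fps_nth (moment_fps w) 0 \<noteq> 0"
      using suminf_pos[OF w_summable pos] by (simp add: moment_fps_def moment_0)
    show "(\<lambda>L. fps_nth (truncated_fps (Suc L)) k) \<longlonglongrightarrow> fps_nth (moment_fps w) k" for k
      using LIMSEQ_Suc[OF summable_LIMSEQ[OF summable_moment[of k]]]
      by (simp add: truncated_fps_def moment_fps_def moment_def)
  qed
  hence "(\<lambda>L. suminf (\<lambda>j. a j L)) \<longlonglongrightarrow> fps_nth (fps_dlog (moment_fps w)) (k - 1) - 0"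
    unfolding sum_a by (intro tendsto_diff pow0)
  hence "suminf b = fps_nth (fps_dlog (moment_fps w)) (k - 1)"
    using LIMSEQ_unique[OF b(2)] by simp
  moreover have "b = (\<lambda>n. 1 / real (Suc n) ^ k - 1 / \<rho> (Suc n) ^ k)"
    by (simp add: b_def fun_eq_iff power_one_over)
  ultimately show ?thesis
    using summable_sums[OF summable_norm_cancel[OF b(1)]] by simp
qed

end

section \<open>A partial fraction expansion of a quotient of Gamma functions\<close>

text \<open>The coefficient of t^(j+1) in 1 - (1 - t)^x.\<close>

definition binom_weight :: "real \<Rightarrow> nat \<Rightarrow> real" where
  "binom_weight x j = (-1) ^ j * (x gchoose Suc j)"

text \<open>The coefficient of t^j in (1 - t)^(x-1), a factor of the Beta integrand. Multiplying by
  1 - t and differentiating (1 - t)^x give the two relations with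
  \<open>binom_weight\<close>.\<close>

definition beta_coeff :: "real \<Rightarrow> nat \<Rightarrow> real" where
  "beta_coeff x j = (-1) ^ j * ((x - 1) gchoose j)"

lemma beta_coeff_pos:
  assumes "x < 1"
  shows "beta_coeff x j > 0"
proof -
  have "beta_coeff x j = pochhammer (1 - x) j / fact j"
    by (simp add: beta_coeff_def gbinomial_pochhammer flip: power_mult_distrib)
  thus ?thesis using pochhammer_pos[of "1 - x" j] assms by simp
qed

lemma binom_weight_diff: "binom_weight x j = beta_coeff x j - beta_coeff x (Suc j)"
  using gbinomial_Suc_Suc[of "x - 1" j] by (simp add: binom_weight_def beta_coeff_def algebra_simps)

lemma binom_weight_absorb: "real (Suc j) * binom_weight x j = x * beta_coeff x j"
  using gbinomial_absorption[of j x] by (simp add: binom_weight_def beta_coeff_def)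

lemma sum_binom_weight: "(\<Sum>j<N. binom_weight x j) = 1 - beta_coeff x N"
  by (induction N) (simp_all add: binom_weight_diff, simp add: beta_coeff_def)

context
  fixes x :: real
  assumes x: "0 < x" "x < 1"
begin

lemma binom_weight_pos: "binom_weight x j > 0"
proof -
  have "real (Suc j) * binom_weight x j > 0"
    unfolding binom_weight_absorb using x beta_coeff_pos[of x j] by simp
  thus ?thesis by (simp add: zero_less_mult_iff)
qed

lemma sum_binom_weight_le: "(\<Sum>j<N. binom_weight x j) \<le> 1"
  using sum_binom_weight[of x N] beta_coeff_pos[of x N] x by simp

interpretation summable_weights "binom_weight x"
proof
  show "summable (binom_weight x)"
    by (rule summableI_nonneg_bounded[of _ 1])
       (use binom_weight_pos sum_binom_weight_le in \<open>auto intro: less_imp_le\<close>)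
  show "binom_weight x j \<ge> 0" for j using binom_weight_pos[of j] by simp
qed

lemmas summable_weights_binom_weight = summable_weights_axioms

text \<open>The binomial series of (1 - t)^(x-1) is integrated termwise against t^(-z). As its
  coefficients are positive, the Beta integrand itself dominates the partial sums.\<close>

lemma beta_coeff_sums_Beta:
  assumes "z < 1"
  shows "(\<lambda>j. beta_coeff x j / (real (Suc j) - z)) sums Beta (1 - z) x"
proof -
  let ?g = "\<lambda>t. t powr (- z) * (1 - t) powr (x - 1)"
  let ?f = "\<lambda>N t. \<Sum>j<N. beta_coeff x j * t powr (real j - z)"
  have g: "(?g has_integral Beta (1 - z) x) {0<..<1}"
    using has_integral_Beta_real[of "1 - z" x] assms x by (simp add: has_integral_Icc_iff_Ioo)
  have f: "(?f N has_integral (\<Sum>j<N. beta_coeff x j / (real (Suc j) - z))) {0<..<1}" for N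
  proof (intro has_integral_sum finite_lessThan)
    fix j
    have "((\<lambda>t. t powr (real j - z)) has_integral 1 / (real (Suc j) - z)) {0<..<1}"
      using has_integral_powr_from_0[of "real j - z" 1] assms
      by (simp add: has_integral_Icc_iff_Ioo algebra_simps)
    from has_integral_mult_right[OF this, of "beta_coeff x j"]
    show "((\<lambda>t. beta_coeff x j * t powr (real j - z)) has_integral beta_coeff x j / (real (Suc j) - z)) {0<..<1}"
      by simp
  qed
  have sums: "(\<lambda>j. beta_coeff x j * t powr (real j - z)) sums ?g t" if t: "t \<in> {0<..<1}" for t
  proof -
    have "(\<lambda>j. ((x - 1) gchoose j) * (- t) ^ j) sums (1 - t) powr (x - 1)"
      using gen_binomial_real[of "- t" "x - 1"] t by simp
    hence "(\<lambda>j. t powr (- z) * (((x - 1) gchoose j) * (- t) ^ j)) sums ?g t"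
      by (rule sums_mult)
    moreover have "t powr (- z) * (((x - 1) gchoose j) * (- t) ^ j) = beta_coeff x j * t powr (real j - z)" for j
    proof -
      have "t powr (real j - z) = t powr (- z) * t ^ j"
        using t by (simp add: powr_diff powr_minus powr_realpow field_simps)
      thus ?thesis using power_mult_distrib[of "-1" t j] by (simp add: beta_coeff_def)
    qed
    ultimately show ?thesis by simp
  qed
  have le: "norm (?f N t) \<le> ?g t" if "t \<in> {0<..<1}" for N t
  proof -
    have nn: "0 \<le> beta_coeff x j * t powr (real j - z)" for j
      using beta_coeff_pos[of x j] x by simp
    have "?f N t \<le> ?g t"
      using sum_le_suminf[of "\<lambda>j. beta_coeff x j * t powr (real j - z)" "{..<N}"] sums[OF that] nn
      by (simp add: sums_iff)
    moreover have "?f N t \<ge> 0" by (rule sum_nonneg) (rule nn)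
    ultimately show ?thesis by simp
  qed
  have "(\<lambda>N. integral {0<..<1} (?f N)) \<longlonglongrightarrow> integral {0<..<1} ?g"
  proof (rule dominated_convergence(2)[where h = ?g])
    show "?f N integrable_on {0<..<1}" for N using f[of N] by blast
    show "?g integrable_on {0<..<1}" using g by blast
    show "norm (?f N t) \<le> ?g t" if "t \<in> {0<..<1}" for N t using le[OF that] .
    show "(\<lambda>N. ?f N t) \<longlonglongrightarrow> ?g t" if "t \<in> {0<..<1}" for t using sums[OF that] by (simp add: sums_def)
  qed
  thus ?thesis
    unfolding sums_def by (simp only: integral_unique[OF f] integral_unique[OF g])
qed

lemma pole_sum_binom_weight_real:
  assumes "z < 1"
  shows "pole_sum (binom_weight x) (of_real z) =
    Gamma (1 - of_real z) * Gamma (of_real x + 1) * rGamma (of_real x + 1 - of_real z)"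
proof -
  have eq: "of_real (binom_weight x j) * (of_nat (Suc j) / (of_nat (Suc j) - complex_of_real z)) =
     complex_of_real (x * (beta_coeff x j / (real (Suc j) - z)))" for j
  proof -
    have "binom_weight x j * (real (Suc j) / (real (Suc j) - z)) =
        real (Suc j) * binom_weight x j / (real (Suc j) - z)" by simp
    also have "\<dots> = x * (beta_coeff x j / (real (Suc j) - z))" unfolding binom_weight_absorb by simp
    finally have "complex_of_real (binom_weight x j * (real (Suc j) / (real (Suc j) - z))) =
        complex_of_real (x * (beta_coeff x j / (real (Suc j) - z)))" by (rule arg_cong)
    thus ?thesis by simp
  qed
  have "pole_sum (binom_weight x) (of_real z) = of_real (x * Beta (1 - z) x)"
    unfolding pole_sum_def eq
    by (rule sums_unique[symmetric], rule sums_of_real, rule sums_mult, rule beta_coeff_sums_Beta[OF assms])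
  also have "x * Beta (1 - z) x = Gamma (1 - z) * Gamma (x + 1) * rGamma (x + 1 - z)"
  proof -
    have "x \<notin> \<int>\<^sub>\<le>\<^sub>0" using x by (auto elim!: nonpos_Ints_cases')
    hence "Gamma (x + 1) = x * Gamma x" by (rule Gamma_plus1)
    thus ?thesis by (simp add: Beta_altdef algebra_simps)
  qed
  also have "of_real \<dots> = Gamma (1 - of_real z) * Gamma (of_real x + 1) * rGamma (of_real x + 1 - complex_of_real z)"
    by (simp flip: Gamma_complex_of_real rGamma_complex_of_real)
  finally show ?thesis .
qed

text \<open>The Beta integral covers only real z < 1. Both sides are holomorphic off the poles, a
  connected set because its complement is countable, so agreement on (0, 1), which accumulates at 0,
  extends.\<close>

lemma pole_sum_binom_weight:
  assumes "z \<notin> posnats"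
  shows "pole_sum (binom_weight x) z =
    Gamma (1 - z) * Gamma (of_real x + 1) * rGamma (of_real x + 1 - z)"
proof -
  let ?F = "\<lambda>z. pole_sum (binom_weight x) z - Gamma (1 - z) * Gamma (of_real x + 1) * rGamma (of_real x + 1 - z)"
  have notin: "complex_of_real r \<notin> posnats" if "r < 1" for r
  proof
    assume "complex_of_real r \<in> posnats"
    then obtain j where "complex_of_real r = complex_of_real (real (Suc j))" by auto
    hence "r = real (Suc j)" by (simp only: of_real_eq_iff)
    thus False using that by simp
  qed
  have "?F z = 0"
  proof (rule analytic_continuation[of ?F "- posnats" "of_real ` {0<..<1}" 0])
    show "?F holomorphic_on - posnats"
    proof (intro holomorphic_intros pole_sum_holomorphic holomorphic_Gamma')
      fix y :: complex assume y: "y \<in> - posnats"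
      show "1 - y \<notin> \<int>\<^sub>\<le>\<^sub>0"
      proof
        assume "1 - y \<in> \<int>\<^sub>\<le>\<^sub>0"
        then obtain n where "1 - y = - of_nat n" by (auto elim!: nonpos_Ints_cases')
        hence "y = of_nat (Suc n)" by (simp add: algebra_simps)
        thus False using y by blast
      qed
    qed
    show "open (- posnats)" by (rule open_Compl_posnats)
    show "connected (- posnats)"
      by (intro path_connected_imp_connected path_connected_complement_countable) auto
    show "of_real ` {0<..<1} \<subseteq> - posnats"
      using notin by (intro image_subsetI ComplI) auto
    show "0 \<in> - posnats" using notin[of 0] by simp
    show "(0::complex) islimpt of_real ` {0<..<1}"
      unfolding islimpt_approachable
    proof (intro allI impI)
      fix e :: real assume "e > 0"
      thus "\<exists>y\<in>complex_of_real ` {0<..<1}. y \<noteq> 0 \<and> dist y 0 < e"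
        by (intro bexI[of _ "of_real (min (1/2) (e/2))"]) (auto simp: min_def)
    qed
    show "?F y = 0" if y: "y \<in> of_real ` {0<..<1}" for y
      using y pole_sum_binom_weight_real by auto
    show "z \<in> - posnats" using assms by simp
  qed
  thus ?thesis by simp
qed

lemma suminf_binom_weight: "suminf (binom_weight x) = 1"
proof -
  have "complex_of_real (suminf (binom_weight x)) = pole_sum (binom_weight x) 0"
    using pole_sum_power_series[of 0] by (simp add: moment_0 sums_iff powser_sums_zero_iff)
  also have "\<dots> = Gamma (of_real x + 1) * rGamma (of_real x + 1)"
    using pole_sum_binom_weight_real[of 0] by simp
  also have "\<dots> = 1"
  proof -
    have "Gamma (x + 1) \<noteq> 0"
      using Gamma_real_pos[OF add_pos_pos[OF x(1) zero_less_one]] by linarith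
    hence "Gamma (complex_of_real (x + 1)) \<noteq> 0" by (simp only: Gamma_complex_of_real of_real_eq_0_iff) simp
    hence "Gamma (complex_of_real x + 1) \<noteq> 0" by simp
    thus ?thesis by (simp add: rGamma_inverse_Gamma)
  qed
  finally show ?thesis by simp
qed

text \<open>Derivative at 0 of both sides of the Gamma quotient formula; Euler's constant enters as
  -\<open>Digamma 1\<close>.\<close>

lemma moment_binom_weight_1: "moment (binom_weight x) 1 = Digamma (x + 1) + euler_mascheroni"
proof -
  let ?c = "binom_weight x"
  have ev: "eventually (\<lambda>z::complex. z \<in> ball 0 1) (nhds 0)"
    by (intro eventually_nhds_in_open) auto
  have "pole_sum ?c has_fps_expansion Abs_fps (\<lambda>k. of_real (moment ?c k))"
    by (rule has_fps_expansionI, rule eventually_mono[OF ev]) (use pole_sum_power_series in auto)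
  from has_fps_expansion_imp_0_eq_fps_nth_0[OF has_fps_expansion_deriv[OF this]]
  have "complex_of_real (moment ?c 1) = deriv (pole_sum ?c) 0" by simp
  also have "\<dots> = deriv (\<lambda>z. Gamma (1 - z) * Gamma (of_real x + 1) * rGamma (of_real x + 1 - z)) 0"
  proof (rule deriv_cong_ev[OF _ refl])
    have "eventually (\<lambda>z. z \<in> - posnats) (nhds 0)"
      by (intro eventually_nhds_in_open open_Compl_posnats) (auto simp: image_iff simp del: of_nat_Suc)
    thus "eventually (\<lambda>z. pole_sum ?c z = Gamma (1 - z) * Gamma (of_real x + 1) * rGamma (of_real x + 1 - z)) (nhds 0)"
      by eventually_elim (use pole_sum_binom_weight in auto)
  qed
  also have "\<dots> = Digamma (of_real x + 1) + euler_mascheroni"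
  proof (rule DERIV_imp_deriv)
    let ?y = "complex_of_real x + 1"
    have "complex_of_real (x + 1) \<notin> \<int>\<^sub>\<le>\<^sub>0"
      unfolding of_real_in_nonpos_Ints_iff using x by (auto simp: nonpos_Ints_def)
    hence y: "?y \<notin> \<int>\<^sub>\<le>\<^sub>0" by simp
    hence 1: "Gamma ?y * rGamma ?y = 1"
      by (simp add: rGamma_inverse_Gamma Gamma_eq_zero_iff)
    have "((\<lambda>z. Gamma (1 - z) * Gamma ?y * rGamma (?y - z)) has_field_derivative
        - Digamma 1 * (Gamma ?y * rGamma ?y) + Gamma ?y * rGamma ?y * Digamma ?y) (at 0)"
      using y by (auto intro!: derivative_eq_intros simp: algebra_simps)
    thus "((\<lambda>z. Gamma (1 - z) * Gamma ?y * rGamma (?y - z)) has_field_derivative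
        Digamma ?y + euler_mascheroni) (at 0)"
      unfolding 1 by (simp add: add.commute)
  qed
  also have "\<dots> = of_real (Digamma (x + 1) + euler_mascheroni)"
    using Polygamma_of_real[of "x + 1" 0, where ?'a = complex] x by simp
  finally show ?thesis by (simp only: of_real_eq_iff)
qed

end

section \<open>The Gregory coefficients as integrals\<close>

text \<open>This is |G_n| for n = j + 1: up to sign, G_n is the integral over [0, 1] of the binomial
  coefficient x over n.\<close>

definition gregory_weight :: "nat \<Rightarrow> real" where
  "gregory_weight j = integral {0..1} (\<lambda>x. binom_weight x j)"

lemma continuous_on_binom_weight: "continuous_on A (\<lambda>x. binom_weight x j)"
  unfolding binom_weight_def gbinomial_prod_rev by (intro continuous_intros) auto

lemma gregory_weight_has_integral:
  "((\<lambda>x. binom_weight x j) has_integral gregory_weight j) {0<..<1}"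
  using integrable_integral[OF integrable_continuous_real[OF continuous_on_binom_weight]]
  by (simp add: gregory_weight_def has_integral_Icc_iff_Ioo)

lemma gregory_weight_pos: "gregory_weight j > 0"
proof -
  have nn: "binom_weight x j \<ge> 0" if "x \<in> {0..1}" for x
  proof -
    \<comment> \<open>At the endpoint x = 1 the coefficients are 1, 0, 0, ..., so strict positivity
      fails and this case is separate.\<close>
    have "beta_coeff 1 j \<ge> 0" by (cases j) (auto simp: beta_coeff_def)
    hence "real (Suc j) * binom_weight x j \<ge> 0"
      unfolding binom_weight_absorb using that beta_coeff_pos[of x j] by (cases "x = 1") auto
    thus ?thesis by (simp add: zero_le_mult_iff)
  qed
  have "gregory_weight j \<noteq> 0"
    unfolding gregory_weight_def
  proof (subst integral_eq_0_iff[OF continuous_on_binom_weight])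
    have "binom_weight (1/2) j \<noteq> 0" using binom_weight_pos[of "1/2" j] by simp
    thus "\<not> (\<forall>x\<in>{0..1}. binom_weight x j = 0)" by (auto intro!: bexI[of _ "1/2"])
  qed (use nn in auto)
  moreover have "gregory_weight j \<ge> 0"
    unfolding gregory_weight_def
    by (intro integral_nonneg integrable_continuous_real continuous_on_binom_weight nn)
  ultimately show ?thesis by simp
qed

lemma gregory_weight_positive: "positive_weights gregory_weight"
proof
  show "summable gregory_weight"
  proof (rule summableI_nonneg_bounded[of _ 1])
    fix N
    have "((\<lambda>x. \<Sum>j<N. binom_weight x j) has_integral (\<Sum>j<N. gregory_weight j)) {0<..<1}"
      by (intro has_integral_sum gregory_weight_has_integral) auto
    moreover have "((\<lambda>x::real. 1::real) has_integral 1) {0<..<1}"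
      using has_integral_const_real[of "1::real" 0 1] by (simp add: has_integral_Icc_iff_Ioo)
    ultimately show "(\<Sum>j<N. gregory_weight j) \<le> 1"
      by (rule has_integral_le) (use sum_binom_weight_le in auto)
  qed (use gregory_weight_pos less_imp_le in auto)
qed (rule gregory_weight_pos)

interpretation gregory_weight: positive_weights gregory_weight
  by (rule gregory_weight_positive)

text \<open>Carries identities for fixed x over to the Gregory weights. Since the binomial weights
  are positive with partial sums at most 1, the constant \<open>K\<close> dominates.\<close>

lemma has_integral_binom_weight_series:
  fixes a :: "nat \<Rightarrow> complex"
  assumes a: "\<And>j. cmod (a j) \<le> K"
  shows "((\<lambda>x. \<Sum>j. of_real (binom_weight x j) * a j) has_integral
          (\<Sum>j. of_real (gregory_weight j) * a j)) {0<..<1}"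
proof (rule has_integral_dominated_convergence[where h = "\<lambda>_. K"])
  show "((\<lambda>x. \<Sum>j<N. of_real (binom_weight x j) * a j) has_integral
      (\<Sum>j<N. of_real (gregory_weight j) * a j)) {0<..<1}" for N
    by (intro has_integral_sum has_integral_mult_left has_integral_of_real gregory_weight_has_integral) auto
  show "(\<lambda>_::real. K) integrable_on {0<..<1}"
    using integrable_on_open_interval_real[of "\<lambda>_. K" 0 1] by (simp add: integrable_on_const)
  show "\<forall>x\<in>{0<..<1}. norm (\<Sum>j<N. of_real (binom_weight x j) * a j) \<le> K" for N
  proof
    fix x :: real assume x: "x \<in> {0<..<1}"
    have "norm (\<Sum>j<N. of_real (binom_weight x j) * a j) \<le> (\<Sum>j<N. binom_weight x j * K)"
    proof (rule sum_norm_le)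
      fix j
      show "norm (of_real (binom_weight x j) * a j) \<le> binom_weight x j * K"
        using mult_left_mono[OF a[of j], of "binom_weight x j"] binom_weight_pos[of x j] x
        by (simp add: norm_mult)
    qed
    also have "\<dots> = (\<Sum>j<N. binom_weight x j) * K" by (simp add: sum_distrib_right)
    also have "\<dots> \<le> 1 * K"
      using sum_binom_weight_le[of x N] x order_trans[OF norm_ge_zero a[of 0]] by (intro mult_right_mono) auto
    finally show "norm (\<Sum>j<N. of_real (binom_weight x j) * a j) \<le> K" by simp
  qed
  show "\<forall>x\<in>{0<..<1}. (\<lambda>N. \<Sum>j<N. of_real (binom_weight x j) * a j) \<longlonglongrightarrow>
      (\<Sum>j. of_real (binom_weight x j) * a j)"
    using summable_LIMSEQ[OF summable_weights.summable_weighted[OF summable_weights_binom_weight a]] by auto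
  show "(\<lambda>N. \<Sum>j<N. of_real (gregory_weight j) * a j) \<longlonglongrightarrow>
      (\<Sum>j. of_real (gregory_weight j) * a j)"
    by (rule summable_LIMSEQ[OF gregory_weight.summable_weighted[OF a]])
qed

lemma suminf_gregory_weight: "suminf gregory_weight = 1"
proof -
  have "((\<lambda>x. \<Sum>j. complex_of_real (binom_weight x j) * 1) has_integral
      (\<Sum>j. of_real (gregory_weight j) * 1)) {0<..<1}"
    by (rule has_integral_binom_weight_series[where K = 1]) simp
  moreover have "(\<Sum>j. complex_of_real (binom_weight x j) * 1) = 1" if "x \<in> {0<..<1}" for x
    using that suminf_binom_weight[of x]
      suminf_of_real[OF summable_weights.summable[OF summable_weights_binom_weight[of x]], where ?'a = complex]
    by simp
  ultimately have "((\<lambda>x::real. 1::complex) has_integral (\<Sum>j. of_real (gregory_weight j))) {0<..<1}"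
    by (subst (asm) has_integral_cong) auto
  moreover have "((\<lambda>x::real. 1::complex) has_integral 1) {0<..<1}"
    using has_integral_const_real[of "1::complex" 0 1] by (simp add: has_integral_Icc_iff_Ioo)
  ultimately have "(\<Sum>j. complex_of_real (gregory_weight j)) = 1" by (rule has_integral_unique)
  hence "complex_of_real (suminf gregory_weight) = 1"
    using suminf_of_real[OF gregory_weight.w_summable, where ?'a = complex] by simp
  thus ?thesis by simp
qed

text \<open>The antiderivative ln \<Gamma>(x + 1) + \<gamma> x has vanishing Gamma part at both
  endpoints, which leaves \<gamma>.\<close>

lemma moment_gregory_weight_1: "moment gregory_weight 1 = euler_mascheroni"
proof -
  let ?a = "\<lambda>j. 1 / complex_of_nat (Suc j)"
  have "cmod (?a j) \<le> 1" for j
    unfolding norm_divide norm_of_nat by simp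
  hence "((\<lambda>x. \<Sum>j. complex_of_real (binom_weight x j) * ?a j) has_integral
      (\<Sum>j. of_real (gregory_weight j) * ?a j)) {0<..<1}"
    by (rule has_integral_binom_weight_series)
  moreover have "(\<Sum>j. complex_of_real (binom_weight x j) * ?a j) =
      of_real (Digamma (x + 1) + euler_mascheroni)" if "x \<in> {0<..<1}" for x
  proof -
    have "(\<Sum>j. complex_of_real (binom_weight x j) * ?a j) = of_real (moment (binom_weight x) 1)"
      unfolding moment_def using that
      by (subst suminf_of_real[OF summable_weights.summable_moment[OF summable_weights_binom_weight]]) auto
    thus ?thesis using that moment_binom_weight_1 by simp
  qed
  moreover have "(\<Sum>j. of_real (gregory_weight j) * ?a j) = complex_of_real (moment gregory_weight 1)"
    unfolding moment_def
    by (subst suminf_of_real[OF gregory_weight.summable_moment]) auto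
  ultimately have 1: "((\<lambda>x. complex_of_real (Digamma (x + 1) + euler_mascheroni)) has_integral
      of_real (moment gregory_weight 1)) {0<..<1}"
    by (subst (asm) has_integral_cong) auto
  have "((\<lambda>x. Digamma (x + 1) + euler_mascheroni) has_integral
      (ln_Gamma (1 + 1) + euler_mascheroni * 1) - (ln_Gamma (0 + 1) + euler_mascheroni * 0 :: real)) {0..1}"
  proof (rule fundamental_theorem_of_calculus)
    fix x :: real assume "x \<in> {0..1}"
    hence "((\<lambda>x. ln_Gamma (x + 1) + euler_mascheroni * x) has_field_derivative
        Digamma (x + 1) + euler_mascheroni) (at x within {0..1})"
      by (auto intro!: derivative_eq_intros)
    thus "((\<lambda>x. ln_Gamma (x + 1) + euler_mascheroni * x) has_vector_derivative
        Digamma (x + 1) + euler_mascheroni) (at x within {0..1})"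
      by (simp add: has_real_derivative_iff_has_vector_derivative)
  qed simp
  moreover have "ln_Gamma (1 + 1 :: real) = 0" "ln_Gamma (0 + 1 :: real) = 0"
    using ln_Gamma_real_conv_fact[of 2] ln_Gamma_real_conv_fact[of 1] by simp_all
  ultimately have "((\<lambda>x. Digamma (x + 1) + euler_mascheroni) has_integral (euler_mascheroni :: real)) {0<..<1}"
    by (simp add: has_integral_Icc_iff_Ioo)
  from has_integral_unique[OF 1 has_integral_of_real[OF this]] show ?thesis
    by (simp only: of_real_eq_iff)
qed

text \<open>The binomial series of (1 + z)^x - 1 is integrated over x in [0, 1], with antiderivative
  (1 + z)^x / log(1 + z) - x.\<close>

lemma gregory_generating_function:
  assumes "cmod z < 1" "z \<noteq> 0"
  shows "(\<lambda>j. of_real ((-1) ^ j * gregory_weight j) * z ^ Suc j) sums (z / Ln (1 + z) - 1)"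
proof -
  let ?a = "\<lambda>j. (-1) ^ j * z ^ Suc j"
  have a: "cmod (?a j) \<le> 1" for j
    using power_le_one[of "cmod z" "Suc j"] assms(1) by (simp add: norm_mult norm_power)
  have nz: "1 + z \<noteq> 0" using assms(1) by (metis add_eq_0_iff norm_minus_cancel norm_one less_irrefl)
  hence L: "Ln (1 + z) \<noteq> 0" using assms(2) by (metis add_cancel_right_right exp_Ln exp_zero)
  have "(\<Sum>j. of_real (binom_weight x j) * ?a j) = (1 + z) powr of_real x - 1" for x
  proof -
    have "(\<lambda>n. (of_real x gchoose n) * z ^ n) sums (1 + z) powr of_real x"
      by (rule gen_binomial_complex[OF assms(1)])
    hence "(\<lambda>n. (of_real x gchoose Suc n) * z ^ Suc n) sums ((1 + z) powr of_real x - 1)"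
      by (subst sums_Suc_iff) simp
    moreover have "(of_real x gchoose Suc n) * z ^ Suc n = of_real (binom_weight x n) * ?a n" for n
    proof -
      have "complex_of_real x gchoose Suc n = of_real (x gchoose Suc n)"
        by (simp add: gbinomial_prod_rev)
      moreover have "(-1) ^ n * (-1) ^ n = (1 :: complex)" by (simp flip: power_mult_distrib)
      ultimately show ?thesis by (simp add: binom_weight_def mult_ac)
    qed
    ultimately have "(\<lambda>n. of_real (binom_weight x n) * ?a n) sums ((1 + z) powr of_real x - 1)"
      by (simp only:)
    thus ?thesis by (rule sums_unique[symmetric])
  qed
  hence "((\<lambda>x. (1 + z) powr of_real x - 1) has_integral (\<Sum>j. of_real (gregory_weight j) * ?a j)) {0<..<1}"
    using has_integral_binom_weight_series[of ?a, OF a] by simp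
  moreover have "((\<lambda>x. (1 + z) powr of_real x - 1) has_integral
      ((1 + z) powr of_real 1 / Ln (1 + z) - of_real 1) - ((1 + z) powr of_real 0 / Ln (1 + z) - of_real 0)) {0..1}"
  proof (rule fundamental_theorem_of_calculus)
    fix x :: real
    have "((\<lambda>x. (1 + z) powr x / Ln (1 + z) - x) has_field_derivative ((1 + z) powr of_real x - 1)) (at (of_real x))"
      using nz L by (auto intro!: derivative_eq_intros simp: powr_def)
    thus "((\<lambda>x. (1 + z) powr of_real x / Ln (1 + z) - of_real x) has_vector_derivative
       ((1 + z) powr of_real x - 1)) (at x within {0..1})"
      by (rule has_vector_derivative_real_field)
  qed simp
  ultimately have "(\<Sum>j. of_real (gregory_weight j) * ?a j) = z / Ln (1 + z) - 1"
    using nz by (auto simp: has_integral_Icc_iff_Ioo diff_divide_distrib[symmetric] dest: has_integral_unique)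
  moreover have "summable (\<lambda>j. of_real (gregory_weight j) * ?a j)"
    by (rule gregory_weight.summable_weighted[OF a])
  ultimately have "(\<lambda>j. of_real (gregory_weight j) * ?a j) sums (z / Ln (1 + z) - 1)"
    by (simp add: sums_iff)
  thus ?thesis by (simp add: mult_ac)
qed

lemma gregory_coeff_eq: "gregory_coeff n = (case n of 0 \<Rightarrow> 1 | Suc j \<Rightarrow> (-1) ^ j * gregory_weight j)"
proof -
  let ?f = "\<lambda>z::complex. if z = 0 then 1 else z / Ln (1 + z)"
  define g where "g n = (case n of 0 \<Rightarrow> 1 | Suc j \<Rightarrow> (-1) ^ j * gregory_weight j)" for n
  have g: "(\<lambda>n. complex_of_real (g n) * z ^ n) sums ?f z" if "cmod z < 1" for z
  proof (cases "z = 0")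
    case True
    thus ?thesis using powser_sums_zero[of "\<lambda>n. complex_of_real (g n)"] by (simp add: g_def)
  next
    case False
    have "(\<lambda>n. complex_of_real (g (Suc n)) * z ^ Suc n) sums (z / Ln (1 + z) - 1)"
      using gregory_generating_function[OF that False] by (simp add: g_def)
    thus ?thesis using False by (subst (asm) sums_Suc_iff) (simp add: g_def)
  qed
  have exp: "?f has_fps_expansion Abs_fps (\<lambda>n. complex_of_real (G n))"
    if "\<forall>z::complex. norm z < 1 \<longrightarrow> (\<lambda>n. complex_of_real (G n) * z ^ n) sums ?f z" for G
  proof (rule has_fps_expansionI)
    have "eventually (\<lambda>z::complex. z \<in> ball 0 1) (nhds 0)"
      by (intro eventually_nhds_in_open) auto
    thus "eventually (\<lambda>u. (\<lambda>n. fps_nth (Abs_fps (\<lambda>n. complex_of_real (G n))) n * u ^ n) sums ?f u) (nhds 0)"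
      by eventually_elim (use that in simp)
  qed
  have "gregory_coeff = g"
    unfolding gregory_coeff_def
  proof (rule the_equality)
    fix G assume G: "\<forall>z::complex. norm z < 1 \<longrightarrow> (\<lambda>n. complex_of_real (G n) * z ^ n) sums ?f z"
    have "\<forall>z::complex. norm z < 1 \<longrightarrow> (\<lambda>n. complex_of_real (g n) * z ^ n) sums ?f z" using g by blast
    from fps_expansion_unique_complex[OF exp[OF G] exp[OF this]] show "G = g"
      by (auto simp: fps_eq_iff)
  qed (use g in blast)
  from fun_cong[OF this, of n] show ?thesis unfolding g_def .
qed

lemma abs_gregory_coeff: "\<bar>gregory_coeff (Suc j)\<bar> = gregory_weight j"
  using gregory_weight_pos[of j] by (simp add: gregory_coeff_eq abs_mult)

section \<open>The completed Gregory transform\<close>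

lemma gregory_fun_eq_pole_sum:
  assumes z: "z \<notin> \<int>"
  shows "of_real pi * z / sin (of_real pi * z) * gregory_fun z = pole_sum gregory_weight z"
proof -
  have "z \<notin> posnats" using z by auto
  then obtain d K where dK: "d > 0" "\<And>y j. y \<in> cball z d \<Longrightarrow> cmod (of_nat (Suc j) / (of_nat (Suc j) - y)) \<le> K"
    using posnats_pole_bounded by metis
  hence K: "cmod (of_nat (Suc j) / (of_nat (Suc j) - z)) \<le> K" for j by auto
  have int: "((\<lambda>x. pole_sum (binom_weight x) z) has_integral pole_sum gregory_weight z) {0<..<1}"
    unfolding pole_sum_def by (rule has_integral_binom_weight_series[OF K])
  have "((\<lambda>x. Gamma (1 - z) * (Gamma (of_real x + 1) * rGamma (of_real x - z + 1)))
     has_integral pole_sum gregory_weight z) {0<..<1}"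
  proof (rule has_integral_eq[OF _ int])
    fix x :: real assume "x \<in> {0<..<1}"
    thus "pole_sum (binom_weight x) z = Gamma (1 - z) * (Gamma (of_real x + 1) * rGamma (of_real x - z + 1))"
      using pole_sum_binom_weight[of x z] \<open>z \<notin> posnats\<close> by (simp add: algebra_simps)
  qed
  hence "integral {0..1} (\<lambda>x. Gamma (1 - z) * (Gamma (of_real x + 1) * rGamma (of_real x - z + 1)))
      = pole_sum gregory_weight z"
    by (intro integral_unique) (simp add: has_integral_Icc_iff_Ioo)
  hence eq: "Gamma (1 - z) * integral {0..1} (\<lambda>x. Gamma (of_real x + 1) * rGamma (of_real x - z + 1))
      = pole_sum gregory_weight z"
    by simp
  have sin: "sin (of_real pi * z) \<noteq> 0"
    using z sin_eq_0[of "of_real pi * z"] by auto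
  have refl: "rGamma z * rGamma (1 - z) = sin (of_real pi * z) / of_real pi"
    by (rule rGamma_reflection_complex)
  hence "rGamma (1 - z) \<noteq> 0" using sin by auto
  hence "of_real pi * rGamma z / sin (of_real pi * z) = Gamma (1 - z)"
    using refl sin by (simp add: Gamma_def field_simps)
  moreover have "of_real pi * z / sin (of_real pi * z) * rGamma (z + 1) = of_real pi * rGamma z / sin (of_real pi * z)"
    using rGamma_plus1[of z] by (simp add: mult.assoc)
  ultimately have "of_real pi * z / sin (of_real pi * z) * rGamma (z + 1) = Gamma (1 - z)" by simp
  thus ?thesis unfolding gregory_fun_def eq[symmetric] by (simp only: mult.assoc[symmetric])
qed

lemma gregory_H_eq_pole_sum:
  assumes "z \<notin> posnats"
  shows "gregory_H z = pole_sum gregory_weight z"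
  unfolding gregory_H_def
proof (rule remove_sings_eqI)
  have "isCont (pole_sum gregory_weight) z"
    using continuous_on_eq_continuous_at[OF open_Compl_posnats]
      holomorphic_on_imp_continuous_on[OF gregory_weight.pole_sum_holomorphic] assms by blast
  hence "pole_sum gregory_weight \<midarrow>z\<rightarrow> pole_sum gregory_weight z" by (simp add: isCont_def)
  \<comment> \<open>Near \<open>z\<close> no other integer interferes, so the quotient formula holds
    on a punctured neighbourhood; at a nonpositive integer the continuous pole sum is then the value
    filled in by \<open>remove_sings\<close>.\<close>
  moreover have "eventually (\<lambda>w. w \<in> - (\<int> - {z}) - {z}) (at z)"
    by (intro eventually_at_in_open open_Compl closed_subset_Ints) auto
  hence "eventually (\<lambda>w. pole_sum gregory_weight w = of_real pi * w / sin (of_real pi * w) * gregory_fun w) (at z)"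
    by eventually_elim (use gregory_fun_eq_pole_sum in auto)
  ultimately show "(\<lambda>w. of_real pi * w / sin (of_real pi * w) * gregory_fun w) \<midarrow>z\<rightarrow> pole_sum gregory_weight z"
    by (rule Lim_transform_eventually)
qed

lemma gregory_H_power_series:
  assumes "cmod z < 1"
  shows "(\<lambda>k. of_real (moment gregory_weight k) * z ^ k) sums gregory_H z"
  unfolding gregory_H_eq_pole_sum[OF notin_posnats_if_norm_less_1[OF assms]]
  by (rule gregory_weight.pole_sum_power_series[OF assms])

lemma gregory_H_holomorphic: "gregory_H holomorphic_on ball 0 1"
proof (rule holomorphic_transform)
  show "pole_sum gregory_weight holomorphic_on ball 0 1"
  proof (rule holomorphic_on_subset[OF gregory_weight.pole_sum_holomorphic], rule subsetI)
    fix z :: complex assume "z \<in> ball 0 1"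
    hence "z \<notin> posnats" by (intro notin_posnats_if_norm_less_1) simp
    thus "z \<in> - posnats" by (simp only: Compl_iff not_False_eq_True)
  qed
  show "pole_sum gregory_weight z = gregory_H z" if "z \<in> ball 0 1" for z
    using that by (intro gregory_H_eq_pole_sum[symmetric] notin_posnats_if_norm_less_1) simp
qed

lemma gregory_H_0: "gregory_H 0 = 1"
  using gregory_H_power_series[of 0] by (simp add: moment_0 suminf_gregory_weight sums_iff)

text \<open>Every summand \<open>n / (n - z)\<close> has positive real part on the unit disc.\<close>

lemma Re_gregory_H_pos:
  assumes "cmod z < 1"
  shows "Re (gregory_H z) > 0"
proof -
  have sums: "(\<lambda>j. Re (of_real (gregory_weight j) * (of_nat (Suc j) / (of_nat (Suc j) - z)))) sums Re (gregory_H z)"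
    unfolding gregory_H_eq_pole_sum[OF notin_posnats_if_norm_less_1[OF assms]]
    by (intro sums_Re gregory_weight.pole_sum_sums notin_posnats_if_norm_less_1 assms)
  have "Re (of_real (gregory_weight j) * (of_nat (Suc j) / (of_nat (Suc j) - z))) > 0" for j
  proof -
    have "Re z < real (Suc j)" using complex_Re_le_cmod[of z] assms by simp
    hence "Re (of_nat (Suc j) / (of_nat (Suc j) - z)) > 0"
      by (simp add: Re_divide sum_power2_gt_zero_iff del: of_nat_Suc)
    with gregory_weight_pos[of j] show ?thesis
      unfolding scaleR_conv_of_real[symmetric] scaleR_complex.sel by (rule mult_pos_pos)
  qed
  from suminf_pos[OF sums_summable[OF sums] this] show ?thesis
    unfolding sums_unique[OF sums, symmetric] .
qed

text \<open>On the unit disc the transform stays in the right half plane, where the principal branch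
  is holomorphic.\<close>

lemma is_log_H_exists: "is_log_H (\<lambda>z. Ln (gregory_H z))"
proof -
  have *: "gregory_H z \<notin> \<real>\<^sub>\<le>\<^sub>0" "gregory_H z \<noteq> 0" if "z \<in> ball 0 1" for z
    using Re_gregory_H_pos[of z] that by (auto simp: complex_nonpos_Reals_iff)
  have "(\<lambda>z. Ln (gregory_H z)) holomorphic_on ball 0 1"
    using * by (intro holomorphic_intros gregory_H_holomorphic) auto
  thus ?thesis using * by (simp add: is_log_H_def gregory_H_0)
qed

section \<open>Power series of the logarithm and the zeros of the transform\<close>

lemma fps_nth_log_deriv_of_real:
  assumes "fps_nth f 0 \<noteq> 0" "F * Abs_fps (\<lambda>k. of_real (fps_nth f k)) = Abs_fps (\<lambda>k. of_real (fps_nth g k))"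
  shows "fps_nth F k = (of_real (fps_nth (g * inverse f) k) :: complex)"
proof -
  let ?c = "\<lambda>f. Abs_fps (\<lambda>k. complex_of_real (fps_nth f k))"
  have mult: "?c (a * b) = ?c a * ?c b" for a b
    by (simp add: fps_eq_iff fps_mult_nth)
  have "?c f * ?c (inverse f) = 1"
    unfolding mult[symmetric] inverse_mult_eq_1'[OF assms(1)] by (simp add: fps_eq_iff)
  hence "F = F * ?c f * ?c (inverse f)" by (simp add: mult.assoc)
  also have "\<dots> = ?c (g * inverse f)" unfolding assms(2) mult ..
  finally show ?thesis by (metis fps_nth_Abs_fps)
qed

text \<open>Differentiating exp L = H gives L' H = H'. Comparing expansions at 0 determines L', and
  L(0) = 0 fixes the constant.\<close>

lemma log_H_power_series:
  assumes L: "is_log_H L" and z: "cmod z < 1"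
  shows "(\<lambda>k. of_real (fps_nth (fps_dlog (moment_fps gregory_weight)) k) / of_nat (Suc k) * z ^ Suc k) sums L z"
proof -
  have hol: "L holomorphic_on ball 0 1" and L0: "L 0 = 0"
    and exp: "\<And>z. z \<in> ball 0 1 \<Longrightarrow> exp (L z) = gregory_H z"
    using L by (auto simp: is_log_H_def)
  define F where "F = fps_expansion L 0"
  have F: "L has_fps_expansion F"
    unfolding F_def by (rule has_fps_expansion_fps_expansion[OF open_ball _ hol]) simp
  have ev: "eventually (\<lambda>z::complex. z \<in> ball 0 1) (nhds 0)"
    by (intro eventually_nhds_in_open) auto
  let ?M = "Abs_fps (\<lambda>k. complex_of_real (moment gregory_weight k))"
  have H: "gregory_H has_fps_expansion ?M"
    by (rule has_fps_expansionI, rule eventually_mono[OF ev]) (use gregory_H_power_series in auto)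
  have "(\<lambda>z. deriv L z * gregory_H z) has_fps_expansion fps_deriv F * ?M"
    by (intro has_fps_expansion_mult has_fps_expansion_deriv F H)
  moreover have "eventually (\<lambda>z. deriv L z * gregory_H z = deriv gregory_H z) (nhds 0)"
    using ev
  proof eventually_elim
    case (elim z)
    have "(L has_field_derivative deriv L z) (at z)"
      by (rule holomorphic_derivI[OF hol open_ball elim])
    hence "((\<lambda>z. exp (L z)) has_field_derivative exp (L z) * deriv L z) (at z)"
      by (rule DERIV_fun_exp)
    hence "(gregory_H has_field_derivative exp (L z) * deriv L z) (at z)"
      by (rule has_field_derivative_transform_within_open[OF _ open_ball elim exp])
    thus ?case using exp[OF elim] by (simp add: DERIV_imp_deriv mult.commute)
  qed
  ultimately have "deriv gregory_H has_fps_expansion fps_deriv F * ?M"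
    by (subst (asm) has_fps_expansion_cong) auto
  hence "fps_deriv F * ?M = fps_deriv ?M"
    by (rule fps_expansion_unique_complex[OF _ has_fps_expansion_deriv[OF H]])
  also have "fps_deriv ?M = Abs_fps (\<lambda>k. of_real (fps_nth (fps_deriv (moment_fps gregory_weight)) k))"
    by (simp add: fps_eq_iff moment_fps_def)
  finally have "fps_nth (fps_deriv F) k = of_real (fps_nth (fps_dlog (moment_fps gregory_weight)) k)" for k
    unfolding fps_dlog_def
    by (intro fps_nth_log_deriv_of_real) (simp_all add: moment_fps_def moment_0 suminf_gregory_weight)
  hence coeff: "fps_nth F (Suc k) = of_real (fps_nth (fps_dlog (moment_fps gregory_weight)) k) / of_nat (Suc k)" for k
    by (simp add: field_simps del: of_nat_Suc)
  have "(\<lambda>n. (deriv ^^ n) L 0 / fact n * (z - 0) ^ n) sums L z"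
    by (rule holomorphic_power_series[OF hol]) (use z in simp)
  hence "(\<lambda>n. fps_nth F n * z ^ n) sums L z"
    by (simp add: F_def fps_expansion_def)
  hence "(\<lambda>n. fps_nth F (Suc n) * z ^ Suc n) sums L z"
    using has_fps_expansion_imp_0_eq_fps_nth_0[OF F] L0 by (subst sums_Suc_iff) simp
  thus ?thesis by (simp only: coeff)
qed

text \<open>On (n, n + 1) the transform is real and equals \<open>real_pole_sum\<close>, so the
  definite description inherits the unique zero of that function.\<close>

lemma gregory_rho:
  assumes "n \<ge> 1"
  shows "real n < gregory_rho n \<and> gregory_rho n < real n + 1 \<and>
    gregory_weight.real_pole_sum (gregory_rho n) = 0"
proof -
  have "gregory_H (of_real x) = of_real (gregory_weight.real_pole_sum x)"
    if "real n < x" "x < real n + 1" for x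
    using gregory_H_eq_pole_sum[OF of_real_notin_posnats[OF that]]
      gregory_weight.pole_sum_of_real[OF that] by simp
  hence "gregory_rho n = (THE x. real n < x \<and> x < real n + 1 \<and> gregory_weight.real_pole_sum x = 0)"
    unfolding gregory_rho_def by (intro arg_cong[of _ _ The] ext) auto
  thus ?thesis using theI'[OF gregory_weight.real_pole_sum_unique_zero[OF assms]] by simp
qed

theorem theorem7p5:
  shows "(\<forall>k\<ge>1. trace_class (power_diff k) \<and>
            (\<lambda>n. complex_of_real (1 / real (Suc n) ^ k - 1 / gregory_rho (Suc n) ^ k)) sums tau k)
       \<and> (\<exists>L. is_log_H L)
       \<and> (\<forall>L z. is_log_H L \<longrightarrow> norm z < 1 \<longrightarrow>
            (\<lambda>k. tau (Suc k) / of_nat (Suc k) * z ^ Suc k) sums L z)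
       \<and> op_trace (\<lambda>x. T_op x - T_perp x) = of_real euler_mascheroni
       \<and> (\<lambda>n. 1 / real (Suc n) - 1 / gregory_rho (Suc n)) sums euler_mascheroni"
proof -
  let ?D = "fps_dlog (moment_fps gregory_weight)"
  have sum_G: "(\<lambda>j. \<bar>gregory_coeff (Suc j)\<bar>) sums 1"
    using suminf_gregory_weight gregory_weight.w_summable by (simp add: abs_gregory_coeff sums_iff)
  have tau: "tau k = of_real (fps_nth ?D (k - 1))" if "k > 0" for k
    using tau_eq[OF sum_G that] by (simp only: abs_gregory_coeff fps_dlog_def)
  have zeros: "(\<lambda>n. 1 / real (Suc n) ^ k - 1 / gregory_rho (Suc n) ^ k) sums fps_nth ?D (k - 1)"
    if "k > 0" for k
    by (rule gregory_weight.zeros_power_sums[OF gregory_rho that])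
  \<comment> \<open>The constant term of M' / M is the first moment divided by the zeroth, and the
    latter is 1.\<close>
  have D0: "fps_nth ?D 0 = euler_mascheroni"
    using moment_gregory_weight_1
    by (simp add: fps_dlog_def moment_fps_def moment_0 suminf_gregory_weight)
  have "trace_class (power_diff k) \<and>
      (\<lambda>n. complex_of_real (1 / real (Suc n) ^ k - 1 / gregory_rho (Suc n) ^ k)) sums tau k"
    if "k \<ge> 1" for k
    using that trace_class_power_diff[OF sum_G] sums_of_real[OF zeros[of k], where ?'a = complex]
    by (simp add: tau)
  moreover have "(\<lambda>k. tau (Suc k) / of_nat (Suc k) * z ^ Suc k) sums L z"
    if "is_log_H L" "norm z < 1" for L z
    using log_H_power_series[OF that] by (simp only: tau zero_less_Suc diff_Suc_1)
  moreover have "op_trace (\<lambda>x. T_op x - T_perp x) = of_real euler_mascheroni"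
  proof -
    have "(\<lambda>x. T_op x - T_perp x) = power_diff 1" by (simp add: power_diff_def fun_eq_iff)
    thus ?thesis using tau[of 1] D0 by (simp add: tau_def)
  qed
  moreover have "(\<lambda>n. 1 / real (Suc n) - 1 / gregory_rho (Suc n)) sums euler_mascheroni"
    using zeros[of 1] D0 by simp
  ultimately show ?thesis using is_log_H_exists by blast
qed

end
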